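(* Let $\mathcal{J},\mathcal{I}\subseteq\mathcal{K}$ be fractional ideals of $\mathcal{O}$ with $\mathcal{J}\subseteq\mathcal{I}$, $D=\nu(\mathcal{J})$ and $E=\nu(\mathcal{I})$. Then $$\ell_{\mathcal{O}}\left(\frac{\mathcal{I}}{\mathcal{J}}\right)=\sum_{i\in I}\left(\ell_i\left(\frac{\mathcal{I}_i}{\mathcal{J}_i}\right)+\sharp\left(D_i\setminus\nu_i\left(\mathcal{N}_{[1,i)}(\mathcal{J})\right)\right)-\sharp\left(E_i\setminus\nu_i\left(\mathcal{N}_{[1,i)}(\mathcal{I})\right)\right)\right),$$ or equivalently, $$\ell_{\mathcal{O}}\left(\frac{\mathcal{I}}{\mathcal{J}}\right)=\sum_{i\in I}\ell_i\left(\frac{\pi_i(\mathcal{N}_{[1,i)}(\mathcal{I}))}{\pi_i(\mathcal{N}_{[1,i)}(\mathcal{J}))}\right).$$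
   Context: $\mathbb{K}$ is an algebraically closed field of arbitrary characteristic, and $\mathcal{O}=\mathbb{K}[[X_1,\ldots,X_n]]/\mathfrak{A}$ is the local ring of a reduced algebroid curve ($\mathfrak{A}$ a radical ideal), with minimal primes $\wp_1,\ldots,\wp_r$; $I=\{1,\ldots,r\}$ and $\mathcal{O}_i=\mathcal{O}/\wp_i$. The integral closure of $\mathcal{O}_i$ is identified with $\mathbb{K}[[t_i]]$, its fraction field is $\mathcal{K}_i=\mathbb{K}((t_i))$, and $\mathcal{O}\subset\prod_{i\in I}\mathcal{O}_i\subset\mathcal{K}=\prod_{i\in I}\mathbb{K}((t_i))$, the total ring of fractions of $\mathcal{O}$. $\pi_i:\mathcal{K}\to\mathcal{K}_i$ is the projection. A fractional ideal of $\mathcal{O}$ is an $\mathcal{O}$-submodule $\mathcal{I}$ of $\mathcal{K}$ that contains a regular element (non-zero-divisor) $g\in\mathcal{O}$ with $g\mathcal{I}\subseteq\mathcal{O}$; put $\mathcal{I}_i=\pi_i(\mathcal{I})$. $\nu_i$ is the $t_i$-adic order on $\mathcal{K}_i$ with $\nu_i(0)=\infty$; for $z\in\mathcal{K}$, $\nu_i(z):=\nu_i(\pi_i(z))$ and $\nu(z)=(\nu_1(z),\ldots,\nu_r(z))\in(\mathbb{Z}\cup\{\infty\})^r$. If $E=\nu(\mathcal{I})$ is the value set of $\mathcal{I}$, then $E_i=\nu_i(\mathcal{I}_i)$ (similarly $D_i=\nu_i(\mathcal{J}_i)$). For $L\subseteq I$, $\mathcal{N}_L(\mathcal{I})=\{z\in\mathcal{I}:\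 \pi_l(z)=0\ \text{for all } l\in L\}$. $[1,i)=\{1,\ldots,i-1\}$, and for $i=1$ the convention is that $\pi_1(\mathcal{N}_{[1,1)}(\mathcal{I}))=\mathcal{I}_1$ (i.e. $\mathcal{N}_\emptyset(\mathcal{I})=\mathcal{I}$), and likewise for $\mathcal{J}$. $\ell_{\mathcal{O}}$ and $\ell_i$ denote length as $\mathcal{O}$-module and as $\mathcal{O}_i$-module, respectively; $\sharp$ denotes cardinality. *)

theory Defs
  imports
    "HOL-Algebra.Algebra"
    "HOL-Algebra.Algebraic_Closure_Type"
    "HOL-Computational_Algebra.Formal_Laurent_Series"
    "HOL-Library.Extended"
    "HOL-Library.Extended_Nat"
begin

section \<open>Multivariate formal power series\<close>

text \<open>The variables are indexed by a finite type \<open>'n\<close>. A power series is the family of its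
  coefficients; an exponent is a function \<open>'n \<Rightarrow> nat\<close>, and \<open>{..m}\<close> is the finite set of
  exponents that are pointwise at most \<open>m\<close>.\<close>

type_synonym ('n, 'k) mps = "('n \<Rightarrow> nat) \<Rightarrow> 'k"

definition mps_const :: "'k::zero \<Rightarrow> ('n, 'k) mps" where
  "mps_const c = (\<lambda>m. if m = (\<lambda>_. 0) then c else 0)"

definition mps_ring :: "('n::finite, 'k::comm_ring_1) mps ring" where
  "mps_ring = \<lparr>carrier = UNIV,
     monoid.mult = (\<lambda>f g m. \<Sum>a\<in>{..m}. f a * g (\<lambda>j. m j - a j)),
     one = mps_const 1,
     ring.zero = mps_const 0,
     add = (\<lambda>f g m. f m + g m)\<rparr>"

lemma finite_atMost_exponent: "finite {..m :: 'n::finite \<Rightarrow> nat}"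
proof -
  have "{..m} \<subseteq> (\<Pi>\<^sub>E j\<in>UNIV. {..m j})"
    by (auto simp: le_fun_def)
  thus ?thesis
    by (rule finite_subset) (auto intro: finite_PiE)
qed

lemma cring_mps_ring: "cring (mps_ring :: ('n::finite, 'k::comm_ring_1) mps ring)"
proof -
  define mul :: "('n, 'k) mps \<Rightarrow> ('n, 'k) mps \<Rightarrow> ('n, 'k) mps"
    where "mul = (\<lambda>f g m. \<Sum>a\<in>{..m}. f a * g (\<lambda>j. m j - a j))"
  have fin [simp]: "finite {..m}" for m :: "'n \<Rightarrow> nat"
    by (rule finite_atMost_exponent)
  have comm: "mul f g = mul g f" for f g
  proof
    fix m :: "'n \<Rightarrow> nat"
    show "mul f g m = mul g f m"
      unfolding mul_def
      by (rule sum.reindex_bij_witness[where i = "\<lambda>a j. m j - a j" and j = "\<lambda>a j. m j - a j"])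
        (auto simp: le_fun_def fun_eq_iff mult.commute)
  qed
  have assoc: "mul (mul f g) h = mul f (mul g h)" for f g h
  proof
    fix m :: "'n \<Rightarrow> nat"
    have "mul (mul f g) h m =
        (\<Sum>(a, b)\<in>Sigma {..m} (\<lambda>a. {..a}). f b * g (\<lambda>j. a j - b j) * h (\<lambda>j. m j - a j))"
      by (simp add: mul_def sum_distrib_right sum.Sigma)
    also have "\<dots> = (\<Sum>(b, c)\<in>Sigma {..m} (\<lambda>b. {..\<lambda>j. m j - b j}).
        f b * (g c * h (\<lambda>j. m j - b j - c j)))"
    proof (rule sum.reindex_bij_witness[where i = "\<lambda>(b, c). (\<lambda>j. b j + c j, b)"
          and j = "\<lambda>(a, b). (b, \<lambda>j. a j - b j)"], goal_cases)
      case (1 p)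
      thus ?case by (auto simp: le_fun_def fun_eq_iff)
    next
      case (2 p)
      thus ?case by (auto simp: le_fun_def diff_le_mono) (meson order_trans)
    next
      case (3 p)
      thus ?case by (auto simp: le_fun_def fun_eq_iff)
    next
      case (4 p)
      obtain b c where p: "p = (b, c)" by (cases p)
      have "b j + c j \<le> m j" for j
        using 4 by (auto simp: p le_fun_def le_diff_conv2 add.commute)
      thus ?case by (auto simp: p le_fun_def)
    next
      case (5 p)
      obtain a b where p: "p = (a, b)" by (cases p)
      have "b j \<le> a j" for j
        using 5 by (auto simp: p le_fun_def)
      hence "(\<lambda>j. m j - b j - (a j - b j)) = (\<lambda>j. m j - a j)"
        by auto
      thus ?case by (simp add: p mult.assoc)
    qed
    also have "\<dots> = mul f (mul g h) m"
      by (simp add: mul_def sum_distrib_left sum.Sigma)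
    finally show "mul (mul f g) h m = mul f (mul g h) m" .
  qed
  have one: "mul (mps_const 1) f = f" for f
  proof
    fix m :: "'n \<Rightarrow> nat"
    have "mul (mps_const 1) f m = (\<Sum>a\<in>{..m}. if a = (\<lambda>_. 0) then f m else 0)"
      unfolding mul_def by (rule sum.cong) (auto simp: mps_const_def)
    thus "mul (mps_const 1) f m = f m"
      by (simp add: le_fun_def)
  qed
  have distr: "mul (\<lambda>m. f m + g m) h = (\<lambda>m. mul f h m + mul g h m)" for f g h
    by (simp add: mul_def distrib_right sum.distrib)
  have ring: "mps_ring = \<lparr>carrier = UNIV, monoid.mult = mul, one = mps_const 1,
      ring.zero = mps_const 0, add = (\<lambda>f g m. f m + g m)\<rparr>"
    by (simp add: mps_ring_def mul_def)
  show ?thesis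
  proof (rule cringI)
    show "abelian_group (mps_ring :: ('n, 'k) mps ring)"
    proof (rule abelian_groupI)
      fix f :: "('n, 'k) mps"
      show "\<exists>g\<in>carrier mps_ring. g \<oplus>\<^bsub>mps_ring\<^esub> f = \<zero>\<^bsub>mps_ring\<^esub>"
        by (rule bexI[of _ "\<lambda>m. - f m"]) (auto simp: ring mps_const_def fun_eq_iff)
    qed (auto simp: ring mps_const_def fun_eq_iff)
    show "comm_monoid (mps_ring :: ('n, 'k) mps ring)"
    proof (rule comm_monoidI)
      fix f g :: "('n, 'k) mps"
      show "f \<otimes>\<^bsub>mps_ring\<^esub> g = g \<otimes>\<^bsub>mps_ring\<^esub> f"
        using comm by (simp add: ring)
    qed (auto simp: ring assoc one)
  qed (auto simp: ring distr)
qed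

section \<open>Commutative algebra\<close>

definition radical_of :: "('a, 'm) ring_scheme \<Rightarrow> 'a set \<Rightarrow> 'a set" where
  "radical_of R A = {f \<in> carrier R. \<exists>k::nat. f [^]\<^bsub>R\<^esub> k \<in> A}"

definition minimal_primes :: "('a, 'm) ring_scheme \<Rightarrow> 'a set set" where
  "minimal_primes R =
     {P. primeideal P R \<and> (\<forall>Q. primeideal Q R \<and> Q \<subseteq> P \<longrightarrow> Q = P)}"

definition krull_dim :: "('a, 'm) ring_scheme \<Rightarrow> enat" where
  "krull_dim R = Sup {enat n | n. \<exists>P :: nat \<Rightarrow> 'a set.
     (\<forall>k\<le>n. primeideal (P k) R) \<and> (\<forall>k<n. P k \<subset> P (Suc k))}"

definition regular_element :: "('a, 'm) ring_scheme \<Rightarrow> 'a \<Rightarrow> bool" where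
  "regular_element R g \<longleftrightarrow> g \<in> carrier R \<and>
     (\<forall>x\<in>carrier R. g \<otimes>\<^bsub>R\<^esub> x = \<zero>\<^bsub>R\<^esub> \<longrightarrow> x = \<zero>\<^bsub>R\<^esub>)"

text \<open>The set of elements of the ambient ring \<open>'a\<close> that are integral over the subring \<open>S\<close>.\<close>

definition integral_closure :: "'a::comm_ring_1 set \<Rightarrow> 'a set" where
  "integral_closure S =
     {x. \<exists>p :: 'a poly. lead_coeff p = 1 \<and> (\<forall>k. coeff p k \<in> S) \<and> poly p x = 0}"

text \<open>The quotient of a module by a submodule \<open>N\<close>, on the cosets of \<open>N\<close>. The multiplicative
  fields of the record play no role for modules.\<close>

definition quot_module ::
  "('a, 'b, 'm) module_scheme \<Rightarrow> 'b set \<Rightarrow> ('a, 'b set) module" where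
  "quot_module M N = \<lparr>carrier = a_rcosets\<^bsub>M\<^esub> N, monoid.mult = undefined, one = undefined,
     ring.zero = N, add = set_add M,
     module.smult = (\<lambda>a S. \<Union>x\<in>S. N +>\<^bsub>M\<^esub> (a \<odot>\<^bsub>M\<^esub> x))\<rparr>"

definition module_length ::
  "('a, 'r) ring_scheme \<Rightarrow> ('a, 'b) module \<Rightarrow> enat" where
  "module_length R M = Sup {enat n | n. \<exists>N :: nat \<Rightarrow> 'b set.
     (\<forall>k\<le>n. submodule (N k) R M) \<and> (\<forall>k<n. N k \<subset> N (Suc k))}"

text \<open>The length of \<open>U / V\<close>, for submodules \<open>V \<subseteq> U\<close> of \<open>M\<close>.\<close>

definition quot_length ::
  "('a, 'r) ring_scheme \<Rightarrow> ('a, 'b) module \<Rightarrow> 'b set \<Rightarrow> 'b set \<Rightarrow> enat" where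
  "quot_length R M U V = module_length R (quot_module (M\<lparr>carrier := U\<rparr>) V)"

section \<open>Reduced algebroid curves\<close>

text \<open>Besides the defining ideal, the data consist of an enumeration of the minimal primes by
  \<open>{1..num_branches C}\<close> and, for each branch, an embedding of the branch ring into the field of
  Laurent series. The latter is the identification of the integral closure of the branch ring
  with the ring of power series in one variable.\<close>

record (overloaded) ('n, 'k::zero) curve =
  defining_ideal :: "('n, 'k) mps set"
  num_branches :: nat
  branch_prime :: "nat \<Rightarrow> ('n, 'k) mps set set"
  branch_embed :: "nat \<Rightarrow> ('n, 'k) mps set set \<Rightarrow> 'k fls"

abbreviation branches :: "('n, 'k::zero) curve \<Rightarrow> nat set" where
  "branches C \<equiv> {1..num_branches C}"

definition curve_ring ::
  "('n::finite, 'k::alg_closed_field) curve \<Rightarrow> ('n, 'k) mps set ring" where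
  "curve_ring C = mps_ring Quot (defining_ideal C)"

definition branch_ring ::
  "('n::finite, 'k::alg_closed_field) curve \<Rightarrow> nat \<Rightarrow> ('n, 'k) mps set set ring" where
  "branch_ring C i = curve_ring C Quot (branch_prime C i)"

definition curve_to_branch ::
  "('n::finite, 'k::alg_closed_field) curve \<Rightarrow> nat \<Rightarrow> ('n, 'k) mps set \<Rightarrow> ('n, 'k) mps set set"
  where "curve_to_branch C i x = branch_prime C i +>\<^bsub>curve_ring C\<^esub> x"

definition curve_const ::
  "('n::finite, 'k::alg_closed_field) curve \<Rightarrow> 'k \<Rightarrow> ('n, 'k) mps set" where
  "curve_const C c = defining_ideal C +>\<^bsub>mps_ring\<^esub> mps_const c"

text \<open>\<open>\<psi>\<close> is an embedding of \<open>\<O>\<^sub>i\<close> into \<open>K((t))\<close> over \<open>K\<close> under which \<open>K((t))\<close> is the field of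
  fractions and \<open>K[[t]]\<close> the integral closure of \<open>\<O>\<^sub>i\<close>.\<close>

definition branch_normalization ::
  "('n::finite, 'k::alg_closed_field) curve \<Rightarrow> nat \<Rightarrow> (('n, 'k) mps set set \<Rightarrow> 'k fls) \<Rightarrow> bool"
  where
  "branch_normalization C i \<psi> \<longleftrightarrow>
     \<psi> \<in> ring_hom (branch_ring C i) ring_of_type_algebra \<and>
     inj_on \<psi> (carrier (branch_ring C i)) \<and>
     (\<forall>c. \<psi> (curve_to_branch C i (curve_const C c)) = fls_const c) \<and>
     (\<forall>f. \<exists>a\<in>carrier (branch_ring C i). \<exists>b\<in>carrier (branch_ring C i).
        \<psi> b \<noteq> 0 \<and> f = \<psi> a / \<psi> b) \<and>
     integral_closure (\<psi> ` carrier (branch_ring C i)) = range fps_to_fls"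

definition reduced_algebroid_curve :: "('n::finite, 'k::alg_closed_field) curve \<Rightarrow> bool" where
  "reduced_algebroid_curve C \<longleftrightarrow>
     ideal (defining_ideal C) mps_ring \<and>
     defining_ideal C \<noteq> carrier mps_ring \<and>
     radical_of mps_ring (defining_ideal C) = defining_ideal C \<and>
     bij_betw (branch_prime C) (branches C) (minimal_primes (curve_ring C)) \<and>
     (\<forall>i\<in>branches C. krull_dim (branch_ring C i) = 1 \<and>
        branch_normalization C i (branch_embed C i))"

text \<open>\<open>K((t))\<close> as a module over the \<open>i\<close>-th branch ring.\<close>

definition branch_module ::
  "('n::finite, 'k::alg_closed_field) curve \<Rightarrow> nat \<Rightarrow> (('n, 'k) mps set set, 'k fls) module" where
  "branch_module C i = \<lparr>carrier = UNIV, monoid.mult = (*), one = 1, ring.zero = 0, add = (+),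
     module.smult = (\<lambda>a f. branch_embed C i a * f)\<rparr>"

definition curve_embed ::
  "('n::finite, 'k::alg_closed_field) curve \<Rightarrow> ('n, 'k) mps set \<Rightarrow> nat \<Rightarrow> 'k fls" where
  "curve_embed C x = (\<lambda>i\<in>branches C. branch_embed C i (curve_to_branch C i x))"

text \<open>The total ring of fractions, i.e. the product of the fields \<open>K((t\<^sub>i))\<close>, with its structure
  of a module over the ring of the curve. Its elements are extensional functions on the set of
  branches.\<close>

definition total_fractions ::
  "('n::finite, 'k::alg_closed_field) curve \<Rightarrow> (('n, 'k) mps set, nat \<Rightarrow> 'k fls) module" where
  "total_fractions C = \<lparr>carrier = branches C \<rightarrow>\<^sub>E UNIV,
     monoid.mult = (\<lambda>y z. \<lambda>i\<in>branches C. y i * z i),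
     one = (\<lambda>i\<in>branches C. 1),
     ring.zero = (\<lambda>i\<in>branches C. 0),
     add = (\<lambda>y z. \<lambda>i\<in>branches C. y i + z i),
     module.smult = (\<lambda>x z. \<lambda>i\<in>branches C. curve_embed C x i * z i)\<rparr>"

definition fractional_ideal ::
  "('n::finite, 'k::alg_closed_field) curve \<Rightarrow> (nat \<Rightarrow> 'k fls) set \<Rightarrow> bool" where
  "fractional_ideal C M \<longleftrightarrow>
     submodule M (curve_ring C) (total_fractions C) \<and>
     (\<exists>g. regular_element (curve_ring C) g \<and> curve_embed C g \<in> M \<and>
        (\<forall>z\<in>M. g \<odot>\<^bsub>total_fractions C\<^esub> z \<in> curve_embed C ` carrier (curve_ring C)))"

definition branch_proj :: "nat \<Rightarrow> (nat \<Rightarrow> 'k fls) \<Rightarrow> 'k fls" where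
  "branch_proj i z = z i"

definition vanishing_part ::
  "nat set \<Rightarrow> (nat \<Rightarrow> 'k::zero fls) set \<Rightarrow> (nat \<Rightarrow> 'k fls) set" where
  "vanishing_part L M = {z \<in> M. \<forall>l\<in>L. branch_proj l z = 0}"

text \<open>The \<open>t\<close>-adic order with values in the integers and infinity; the element \<open>Minf\<close> of the
  type \<open>int extended\<close> is never attained.\<close>

definition t_order :: "'k::zero fls \<Rightarrow> int extended" where
  "t_order f = (if f = 0 then Pinf else Fin (fls_subdegree f))"

definition branch_val :: "nat \<Rightarrow> (nat \<Rightarrow> 'k::zero fls) \<Rightarrow> int extended" where
  "branch_val i z = t_order (branch_proj i z)"

end

theory Submission
  imports Defs "HOL-Library.Product_Lexorder"
begin

text \<open>Order \<open>{1..r} \<times> \<int>\<close> lexicographically and send a nonzero \<open>z \<in> \<K>\<close> to the pair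
  \<open>(i, \<nu>\<^sub>i(z))\<close>, where \<open>i\<close> is the first branch on which \<open>z\<close> does not vanish. Two elements of
  equal value differ, up to a constant factor, by an element of larger value, and the elements of
  value at least \<open>s\<close> form a submodule. Hence, as soon as \<open>\<J>\<close> contains all elements of large
  order, the length of \<open>\<I>/\<J>\<close> counts the values of \<open>\<I>\<close> that are not values of \<open>\<J>\<close>. The values
  with first entry \<open>i\<close> are those of \<open>\<N>\<^bsub>[1,i)\<^esub>\<close>; the same count on a single branch gives the second
  formula, and the first one follows by comparing \<open>\<nu>\<^sub>i(\<N>\<^bsub>[1,i)\<^esub>)\<close> with \<open>E\<^sub>i\<close> and \<open>D\<^sub>i\<close>.

  What remains is the existence of a conductor. If \<open>x \<in> \<O>\<close> has positive order on branch \<open>i\<close>, then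
  all power series in \<open>x\<close> lie in \<open>\<O>\<close>, and \<open>K[[t\<^sub>i]]\<close> is generated over them by finitely many powers
  of \<open>t\<^sub>i\<close>. A common denominator of these powers, chosen to vanish on the other branches, multiplies
  \<open>K[[t\<^sub>i]]\<close> into \<open>\<O>\<close>.\<close>

section \<open>Lengths of quotient modules\<close>

context module
begin

lemma submodule_abelian_subgroup:
  assumes "submodule V R M"
  shows "abelian_subgroup V M"
  using assms
  by (intro abelian_subgroupI3)
    (auto simp: additive_subgroup_def submodule_def M.abelian_group_axioms)

lemma submodule_minus_closed:
  assumes "submodule V R M" "x \<in> V" "y \<in> V"
  shows "x \<ominus>\<^bsub>M\<^esub> y \<in> V"
  using submoduleE[OF assms(1)] assms(2,3) by (simp add: a_minus_def)

lemma submodule_zero_closed: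
  assumes "submodule V R M"
  shows "\<zero>\<^bsub>M\<^esub> \<in> V"
  using assms additive_subgroup.zero_closed abelian_subgroup.axioms(1) submodule_abelian_subgroup
  by blast

lemma minus_add_cancel: "\<lbrakk>x \<in> carrier M; y \<in> carrier M\<rbrakk> \<Longrightarrow> x \<ominus>\<^bsub>M\<^esub> y \<oplus>\<^bsub>M\<^esub> y = x"
  by (simp add: a_minus_def M.a_assoc M.l_neg)

text \<open>The union in the definition of the scalar action runs over all representatives. They
  differ by elements of \<open>V\<close>, which \<open>a\<close> maps into \<open>V\<close>, so it
  is a union of one and the same coset.\<close>

lemma quot_module_smult:
  assumes V: "submodule V R M" and a: "a \<in> carrier R" and x: "x \<in> carrier M"
  shows "a \<odot>\<^bsub>quot_module M V\<^esub> (V +>\<^bsub>M\<^esub> x) = V +>\<^bsub>M\<^esub> (a \<odot>\<^bsub>M\<^esub> x)"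
proof -
  interpret V: abelian_subgroup V M by (rule submodule_abelian_subgroup[OF V])
  have "V +>\<^bsub>M\<^esub> (a \<odot>\<^bsub>M\<^esub> y) = V +>\<^bsub>M\<^esub> (a \<odot>\<^bsub>M\<^esub> x)" if y: "y \<in> V +>\<^bsub>M\<^esub> x" for y
  proof -
    obtain v where v: "v \<in> V" "y = v \<oplus>\<^bsub>M\<^esub> x"
      using y by (auto simp: a_r_coset_defs)
    have "a \<odot>\<^bsub>M\<^esub> y = a \<odot>\<^bsub>M\<^esub> v \<oplus>\<^bsub>M\<^esub> a \<odot>\<^bsub>M\<^esub> x"
      using v a x by (simp add: smult_r_distr)
    hence "a \<odot>\<^bsub>M\<^esub> y \<in> V +>\<^bsub>M\<^esub> (a \<odot>\<^bsub>M\<^esub> x)"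
      using submoduleE(4)[OF V a v(1)] by (auto simp: a_r_coset_defs)
    thus ?thesis
      using V.a_repr_independence' a x by (metis smult_closed)
  qed
  moreover have "x \<in> V +>\<^bsub>M\<^esub> x"
    by (rule V.a_rcos_self[OF x])
  ultimately have "(\<Union>y\<in>V +>\<^bsub>M\<^esub> x. V +>\<^bsub>M\<^esub> (a \<odot>\<^bsub>M\<^esub> y)) = V +>\<^bsub>M\<^esub> (a \<odot>\<^bsub>M\<^esub> x)"
    by (intro SUP_eq_const) (blast, assumption)
  thus ?thesis
    by (simp add: quot_module_def)
qed

text \<open>All operations, and even the zero \<open>V\<close>, are written through representatives,
  so that statements about the quotient turn by rewriting into statements about
  \<open>M\<close>.\<close>

lemma quot_module_simps:
  assumes V: "submodule V R M"
  shows "carrier (quot_module M V) = (\<lambda>x. V +>\<^bsub>M\<^esub> x) ` carrier M"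
    and "\<zero>\<^bsub>quot_module M V\<^esub> = V +>\<^bsub>M\<^esub> \<zero>\<^bsub>M\<^esub>"
    and "\<lbrakk>x \<in> carrier M; y \<in> carrier M\<rbrakk> \<Longrightarrow>
      (V +>\<^bsub>M\<^esub> x) \<oplus>\<^bsub>quot_module M V\<^esub> (V +>\<^bsub>M\<^esub> y) = V +>\<^bsub>M\<^esub> (x \<oplus>\<^bsub>M\<^esub> y)"
proof -
  interpret V: abelian_subgroup V M by (rule submodule_abelian_subgroup[OF V])
  show "carrier (quot_module M V) = (\<lambda>x. V +>\<^bsub>M\<^esub> x) ` carrier M"
    by (auto simp: quot_module_def A_RCOSETS_def')
  show "\<zero>\<^bsub>quot_module M V\<^esub> = V +>\<^bsub>M\<^esub> \<zero>\<^bsub>M\<^esub>"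
    by (simp add: quot_module_def V.a_subset)
  show "\<lbrakk>x \<in> carrier M; y \<in> carrier M\<rbrakk> \<Longrightarrow>
      (V +>\<^bsub>M\<^esub> x) \<oplus>\<^bsub>quot_module M V\<^esub> (V +>\<^bsub>M\<^esub> y) = V +>\<^bsub>M\<^esub> (x \<oplus>\<^bsub>M\<^esub> y)"
    by (simp add: quot_module_def V.a_rcos_sum)
qed

lemma quot_module_module:
  assumes V: "submodule V R M"
  shows "module R (quot_module M V)"
proof (rule moduleI)
  show "cring R" by (rule R.is_cring)
  note [simp] = quot_module_simps[OF V] quot_module_smult[OF V]
  show "abelian_group (quot_module M V)"
  proof (rule abelian_groupI, goal_cases)
    case (3 S T U)
    thus ?case by (auto simp: M.a_assoc)
  next
    case (4 S T)
    thus ?case by (auto simp: M.a_comm)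
  next
    case (6 S)
    then obtain x where x: "S = V +>\<^bsub>M\<^esub> x" "x \<in> carrier M" by auto
    show ?case
      by (rule bexI[of _ "V +>\<^bsub>M\<^esub> (\<ominus>\<^bsub>M\<^esub> x)"]) (use x in \<open>auto simp: M.l_neg\<close>)
  qed auto
  show "(a \<oplus> b) \<odot>\<^bsub>quot_module M V\<^esub> S =
      a \<odot>\<^bsub>quot_module M V\<^esub> S \<oplus>\<^bsub>quot_module M V\<^esub> b \<odot>\<^bsub>quot_module M V\<^esub> S"
    if "a \<in> carrier R" "b \<in> carrier R" "S \<in> carrier (quot_module M V)" for a b S
    using that by (auto simp: smult_l_distr)
  show "a \<odot>\<^bsub>quot_module M V\<^esub> (S \<oplus>\<^bsub>quot_module M V\<^esub> T) =
      a \<odot>\<^bsub>quot_module M V\<^esub> S \<oplus>\<^bsub>quot_module M V\<^esub> a \<odot>\<^bsub>quot_module M V\<^esub> T"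
    if "a \<in> carrier R" "S \<in> carrier (quot_module M V)" "T \<in> carrier (quot_module M V)" for a S T
    using that by (auto simp: smult_r_distr)
  show "(a \<otimes> b) \<odot>\<^bsub>quot_module M V\<^esub> S =
      a \<odot>\<^bsub>quot_module M V\<^esub> (b \<odot>\<^bsub>quot_module M V\<^esub> S)"
    if "a \<in> carrier R" "b \<in> carrier R" "S \<in> carrier (quot_module M V)" for a b S
    using that by (auto simp: smult_assoc1)
  show "a \<odot>\<^bsub>quot_module M V\<^esub> S \<in> carrier (quot_module M V)"
    if "a \<in> carrier R" "S \<in> carrier (quot_module M V)" for a S
    using that by auto
  show "\<one> \<odot>\<^bsub>quot_module M V\<^esub> S = S" if "S \<in> carrier (quot_module M V)" for S
    using that by auto
qed

text \<open>Correspondence theorem, from the quotient to \<open>M\<close>. The last claim recovers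
  \<open>N\<close> from its preimage, which keeps lifted chains strict.\<close>

lemma submodule_quot_vimage:
  assumes V: "submodule V R M" and N: "submodule N R (quot_module M V)"
  defines "P \<equiv> {x \<in> carrier M. V +>\<^bsub>M\<^esub> x \<in> N}"
  shows "submodule P R M" "V \<subseteq> P" "(\<lambda>x. V +>\<^bsub>M\<^esub> x) ` P = N"
proof -
  interpret V: abelian_subgroup V M by (rule submodule_abelian_subgroup[OF V])
  interpret Q: module R "quot_module M V" by (rule quot_module_module[OF V])
  note [simp] = quot_module_simps[OF V] quot_module_smult[OF V]
  note NE = Q.submoduleE[OF N] Q.submodule_zero_closed[OF N]
  show "submodule P R M"
  proof (rule submoduleI)
    fix x assume "x \<in> P"
    hence x: "x \<in> carrier M" "V +>\<^bsub>M\<^esub> x \<in> N" by (auto simp: P_def)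
    have "\<ominus>\<^bsub>quot_module M V\<^esub> (V +>\<^bsub>M\<^esub> x) = V +>\<^bsub>M\<^esub> (\<ominus>\<^bsub>M\<^esub> x)"
      by (rule Q.minus_equality) (use x in \<open>auto simp: M.l_neg\<close>)
    with NE(3)[OF x(2)] x show "\<ominus>\<^bsub>M\<^esub> x \<in> P" by (auto simp: P_def)
  next
    fix x y assume "x \<in> P" "y \<in> P"
    thus "x \<oplus>\<^bsub>M\<^esub> y \<in> P"
      using NE(5)[of "V +>\<^bsub>M\<^esub> x" "V +>\<^bsub>M\<^esub> y"] by (auto simp: P_def)
  next
    fix a x assume "a \<in> carrier R" "x \<in> P"
    thus "a \<odot>\<^bsub>M\<^esub> x \<in> P"
      using NE(4)[of a "V +>\<^bsub>M\<^esub> x"] by (auto simp: P_def)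
  qed (use NE(7) in \<open>auto simp: P_def\<close>)
  show "V \<subseteq> P"
  proof
    fix v assume v: "v \<in> V"
    hence "V +>\<^bsub>M\<^esub> v = V" by (rule V.a_rcos_const)
    with v NE(7) V.a_subset show "v \<in> P" by (auto simp: P_def)
  qed
  show "(\<lambda>x. V +>\<^bsub>M\<^esub> x) ` P = N"
    using NE(1) by (auto simp: P_def)
qed

lemma submodule_quot_image:
  assumes V: "submodule V R M" and N: "submodule N R M"
  shows "submodule ((\<lambda>x. V +>\<^bsub>M\<^esub> x) ` N) R (quot_module M V)"
proof -
  interpret Q: module R "quot_module M V" by (rule quot_module_module[OF V])
  note [simp] = quot_module_simps[OF V] quot_module_smult[OF V]
  note NE = submoduleE[OF N] submodule_zero_closed[OF N]
  have c: "x \<in> carrier M" if "x \<in> N" for x using NE(1) that by auto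
  show ?thesis
  proof (rule Q.submoduleI)
    fix S assume "S \<in> (\<lambda>x. V +>\<^bsub>M\<^esub> x) ` N"
    then obtain x where x: "S = V +>\<^bsub>M\<^esub> x" "x \<in> N" by auto
    have "\<ominus>\<^bsub>quot_module M V\<^esub> S = V +>\<^bsub>M\<^esub> (\<ominus>\<^bsub>M\<^esub> x)"
      by (rule Q.minus_equality) (use x c in \<open>auto simp: M.l_neg\<close>)
    with NE(3)[OF x(2)] show "\<ominus>\<^bsub>quot_module M V\<^esub> S \<in> (\<lambda>x. V +>\<^bsub>M\<^esub> x) ` N" by simp
  qed (use NE(1,4,5,7) c in \<open>auto intro!: imageI\<close>)
qed

text \<open>If \<open>s\<close> and some \<open>p \<in> P\<close> had the same coset, then
  \<open>s\<close> would be \<open>p\<close> plus an element of \<open>V \<subseteq> P\<close>,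
  hence in \<open>P\<close>.\<close>

lemma quot_image_strict_mono:
  assumes V: "submodule V R M" and P: "submodule P R M" "V \<subseteq> P" and S: "S \<subseteq> carrier M" "P \<subset> S"
  shows "(\<lambda>x. V +>\<^bsub>M\<^esub> x) ` P \<subset> (\<lambda>x. V +>\<^bsub>M\<^esub> x) ` S"
proof -
  interpret V: abelian_subgroup V M by (rule submodule_abelian_subgroup[OF V])
  obtain s where s: "s \<in> S" "s \<notin> P" using S by auto
  have "V +>\<^bsub>M\<^esub> s \<notin> (\<lambda>x. V +>\<^bsub>M\<^esub> x) ` P"
  proof
    assume "V +>\<^bsub>M\<^esub> s \<in> (\<lambda>x. V +>\<^bsub>M\<^esub> x) ` P"
    then obtain p where p: "p \<in> P" "V +>\<^bsub>M\<^esub> s = V +>\<^bsub>M\<^esub> p" by auto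
    have "s \<in> V +>\<^bsub>M\<^esub> p"
      using V.a_rcos_self[of s] s S p(2) by auto
    then obtain v where "v \<in> V" "s = v \<oplus>\<^bsub>M\<^esub> p" by (auto simp: a_r_coset_defs)
    with P p submoduleE(5)[OF P(1)] s show False by auto
  qed
  with s S show ?thesis by blast
qed

lemma submodule_restrict_iff:
  assumes U: "submodule U R M"
  shows "submodule N R (M\<lparr>carrier := U\<rparr>) \<longleftrightarrow> submodule N R M \<and> N \<subseteq> U"
proof -
  interpret U: module R "M\<lparr>carrier := U\<rparr>"
    by (rule submodule.submodule_is_module[OF U]) (rule module_axioms)
  show ?thesis
  proof (intro iffI conjI)
    assume N: "submodule N R (M\<lparr>carrier := U\<rparr>)"
    show sub: "N \<subseteq> U" using U.submoduleE(1)[OF N] by simp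
    have "module R (M\<lparr>carrier := U\<rparr>\<lparr>carrier := N\<rparr>)"
      by (rule submodule.submodule_is_module[OF N]) (rule U.module_axioms)
    thus "submodule N R M"
      using sub submoduleE(1)[OF U] by (intro module_incl_imp_submodule) auto
  next
    assume N: "submodule N R M \<and> N \<subseteq> U"
    hence "module R (M\<lparr>carrier := N\<rparr>)"
      using submodule.submodule_is_module[of N R M] module_axioms by blast
    with N show "submodule N R (M\<lparr>carrier := U\<rparr>)"
      by (intro U.module_incl_imp_submodule) auto
  qed
qed

end

text \<open>The correspondence theorem turns chains in the quotient into chains of submodules
  between \<open>V\<close> and \<open>U\<close>. The later length computations use this form instead
  of cosets.\<close>

lemma quot_length_eq:
  fixes R :: "('a, 'r) ring_scheme" and M :: "('a, 'b) module"
  assumes "module R M" and U: "submodule U R M" and V: "submodule V R M" and VU: "V \<subseteq> U"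
  shows "quot_length R M U V = Sup {enat n | n. \<exists>N :: nat \<Rightarrow> 'b set.
     (\<forall>k\<le>n. submodule (N k) R M \<and> V \<subseteq> N k \<and> N k \<subseteq> U) \<and> (\<forall>k<n. N k \<subset> N (Suc k))}"
    (is "_ = Sup {enat n | n. ?P n}")
proof -
  interpret module R M by fact
  define G where "G = M\<lparr>carrier := U\<rparr>"
  interpret G: module R G
    unfolding G_def by (rule submodule.submodule_is_module[OF U]) (rule module_axioms)
  have sub: "submodule N R G \<longleftrightarrow> submodule N R M \<and> N \<subseteq> U" for N
    unfolding G_def by (rule submodule_restrict_iff[OF U])
  have VG: "submodule V R G" using V VU sub by simp
  have "(\<exists>N :: nat \<Rightarrow> 'b set set. (\<forall>k\<le>n. submodule (N k) R (quot_module G V)) \<and>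
      (\<forall>k<n. N k \<subset> N (Suc k))) \<longleftrightarrow> ?P n" for n
  proof (intro iffI; elim exE conjE)
    fix N :: "nat \<Rightarrow> 'b set set"
    assume N: "\<forall>k\<le>n. submodule (N k) R (quot_module G V)" and chain: "\<forall>k<n. N k \<subset> N (Suc k)"
    define P where "P k = {x \<in> carrier G. V +>\<^bsub>G\<^esub> x \<in> N k}" for k
    note P = G.submodule_quot_vimage[OF VG N[rule_format], folded P_def]
    show "?P n"
    proof (intro exI[of _ P] conjI allI impI)
      fix k assume k: "k \<le> n"
      show "submodule (P k) R M" "V \<subseteq> P k" "P k \<subseteq> U"
        using P(1,2)[OF k] sub by auto
    next
      fix k assume k: "k < n"
      have "P k \<subseteq> P (Suc k)" using chain k by (auto simp: P_def)
      moreover have "P k \<noteq> P (Suc k)"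
        using P(3)[of k] P(3)[of "Suc k"] chain k
        by (metis Suc_leI less_imp_le_nat psubset_eq)
      ultimately show "P k \<subset> P (Suc k)" by auto
    qed
  next
    fix P :: "nat \<Rightarrow> 'b set"
    assume P: "\<forall>k\<le>n. submodule (P k) R M \<and> V \<subseteq> P k \<and> P k \<subseteq> U"
      and chain: "\<forall>k<n. P k \<subset> P (Suc k)"
    show "\<exists>N :: nat \<Rightarrow> 'b set set. (\<forall>k\<le>n. submodule (N k) R (quot_module G V)) \<and>
      (\<forall>k<n. N k \<subset> N (Suc k))"
    proof (intro exI[of _ "\<lambda>k. (\<lambda>x. V +>\<^bsub>G\<^esub> x) ` P k"] conjI allI impI)
      fix k assume "k \<le> n"
      thus "submodule ((\<lambda>x. V +>\<^bsub>G\<^esub> x) ` P k) R (quot_module G V)"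
        using P sub by (intro G.submodule_quot_image[OF VG]) auto
    next
      fix k assume k: "k < n"
      hence "P (Suc k) \<subseteq> U" using P by simp
      thus "(\<lambda>x. V +>\<^bsub>G\<^esub> x) ` P k \<subset> (\<lambda>x. V +>\<^bsub>G\<^esub> x) ` P (Suc k)"
        using P chain k sub by (intro G.quot_image_strict_mono[OF VG]) (auto simp: G_def)
    qed
  qed
  thus ?thesis
    unfolding quot_length_def module_length_def G_def by simp
qed

section \<open>Intersections and sums of submodules\<close>

context module
begin

lemma submodule_Int:
  assumes "submodule H R M" "submodule K R M"
  shows "submodule (H \<inter> K) R M"
  using submoduleE[OF assms(1)] submoduleE[OF assms(2)]
    submodule_zero_closed[OF assms(1)] submodule_zero_closed[OF assms(2)]
  by (intro submoduleI) auto

lemma submodule_set_add: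
  assumes H: "submodule H R M" and K: "submodule K R M"
  shows "submodule (H <+>\<^bsub>M\<^esub> K) R M"
proof -
  note HE = submoduleE[OF H] submodule_zero_closed[OF H]
  note KE = submoduleE[OF K] submodule_zero_closed[OF K]
  have c: "x \<in> carrier M" if "x \<in> H \<or> x \<in> K" for x
    using that HE(1) KE(1) by auto
  have I: "h \<oplus>\<^bsub>M\<^esub> k \<in> H <+>\<^bsub>M\<^esub> K" if "h \<in> H" "k \<in> K" for h k
    using that by (auto simp: set_add_def')
  show ?thesis
  proof (rule submoduleI)
    show "H <+>\<^bsub>M\<^esub> K \<subseteq> carrier M"
      using c by (auto simp: set_add_def')
    show "\<zero>\<^bsub>M\<^esub> \<in> H <+>\<^bsub>M\<^esub> K"
      using I[OF HE(7) KE(7)] by simp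
  next
    fix x assume "x \<in> H <+>\<^bsub>M\<^esub> K"
    then obtain h k where hk: "x = h \<oplus>\<^bsub>M\<^esub> k" "h \<in> H" "k \<in> K"
      by (auto simp: set_add_def')
    hence "\<ominus>\<^bsub>M\<^esub> x = \<ominus>\<^bsub>M\<^esub> h \<oplus>\<^bsub>M\<^esub> \<ominus>\<^bsub>M\<^esub> k"
      using c by (simp add: M.minus_add)
    thus "\<ominus>\<^bsub>M\<^esub> x \<in> H <+>\<^bsub>M\<^esub> K"
      using I HE(3) KE(3) hk by simp
  next
    fix x y assume "x \<in> H <+>\<^bsub>M\<^esub> K" "y \<in> H <+>\<^bsub>M\<^esub> K"
    then obtain h k h' k' where hk: "x = h \<oplus>\<^bsub>M\<^esub> k" "h \<in> H" "k \<in> K"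
      "y = h' \<oplus>\<^bsub>M\<^esub> k'" "h' \<in> H" "k' \<in> K"
      by (auto simp: set_add_def')
    hence "x \<oplus>\<^bsub>M\<^esub> y = (h \<oplus>\<^bsub>M\<^esub> h') \<oplus>\<^bsub>M\<^esub> (k \<oplus>\<^bsub>M\<^esub> k')"
      using c by (simp add: M.a_ac)
    thus "x \<oplus>\<^bsub>M\<^esub> y \<in> H <+>\<^bsub>M\<^esub> K"
      using I HE(5) KE(5) hk by simp
  next
    fix a x assume a: "a \<in> carrier R" and "x \<in> H <+>\<^bsub>M\<^esub> K"
    then obtain h k where hk: "x = h \<oplus>\<^bsub>M\<^esub> k" "h \<in> H" "k \<in> K"
      by (auto simp: set_add_def')
    hence "a \<odot>\<^bsub>M\<^esub> x = a \<odot>\<^bsub>M\<^esub> h \<oplus>\<^bsub>M\<^esub> a \<odot>\<^bsub>M\<^esub> k"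
      using a c by (simp add: smult_r_distr)
    thus "a \<odot>\<^bsub>M\<^esub> x \<in> H <+>\<^bsub>M\<^esub> K"
      using I HE(4)[OF a] KE(4)[OF a] hk by simp
  qed
qed

end

text \<open>Common setting for a single branch, where \<open>v\<close> is the order, and for the
  whole curve, where \<open>v\<close> is the lexicographic value. \<open>filtration\<close> takes
  the place of the ultrametric inequality, and \<open>leading\<close> lets a scalar cancel leading
  terms of equal value. The value of zero is arbitrary, so zero is always treated apart.\<close>

locale valued_module = module R M
  for R :: "('a, 'r) ring_scheme" and M :: "('a, 'b) module" (structure)
    and v :: "'b \<Rightarrow> 's::linorder" +
  assumes filtration: "submodule {z \<in> carrier M. z = \<zero>\<^bsub>M\<^esub> \<or> s \<le> v z} R M"
    and leading: "\<lbrakk>x \<in> carrier M; y \<in> carrier M; x \<noteq> \<zero>\<^bsub>M\<^esub>; y \<noteq> \<zero>\<^bsub>M\<^esub>; v x = v y\<rbrakk> \<Longrightarrow>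
      \<exists>c\<in>carrier R. x \<ominus>\<^bsub>M\<^esub> c \<odot>\<^bsub>M\<^esub> y = \<zero>\<^bsub>M\<^esub> \<or> v x < v (x \<ominus>\<^bsub>M\<^esub> c \<odot>\<^bsub>M\<^esub> y)"
begin

definition vals :: "'b set \<Rightarrow> 's set" where
  "vals N = v ` (N - {\<zero>\<^bsub>M\<^esub>})"

lemma vals_mono: "N \<subseteq> N' \<Longrightarrow> vals N \<subseteq> vals N'"
  by (auto simp: vals_def)

text \<open>If the value of the difference exceeded that of \<open>x\<close>, then \<open>x\<close>,
  as the sum of the difference and \<open>y\<close>, would lie in a filtration step above its own
  value.\<close>

lemma val_minus_eq:
  assumes x: "x \<in> carrier M" "x \<noteq> \<zero>\<^bsub>M\<^esub>" and y: "y \<in> carrier M" "y = \<zero>\<^bsub>M\<^esub> \<or> v x < v y"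
  shows "x \<ominus>\<^bsub>M\<^esub> y \<noteq> \<zero>\<^bsub>M\<^esub>" "v (x \<ominus>\<^bsub>M\<^esub> y) = v x"
proof -
  define F where "F s = {z \<in> carrier M. z = \<zero>\<^bsub>M\<^esub> \<or> s \<le> v z}" for s
  note FE = submoduleE[OF filtration, folded F_def]
  have eq: "x = (x \<ominus>\<^bsub>M\<^esub> y) \<oplus>\<^bsub>M\<^esub> y" using x y minus_add_cancel by simp
  have "x \<ominus>\<^bsub>M\<^esub> y \<noteq> \<zero>\<^bsub>M\<^esub> \<and> v (x \<ominus>\<^bsub>M\<^esub> y) = v x"
  proof (cases "y = \<zero>\<^bsub>M\<^esub>")
    case True
    hence "x \<ominus>\<^bsub>M\<^esub> y = x" using eq x by (metis M.minus_closed M.r_zero M.zero_closed)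
    thus ?thesis using x by simp
  next
    case False
    hence less: "v x < v y" using y by simp
    have ne: "x \<ominus>\<^bsub>M\<^esub> y \<noteq> \<zero>\<^bsub>M\<^esub>"
    proof
      assume "x \<ominus>\<^bsub>M\<^esub> y = \<zero>\<^bsub>M\<^esub>"
      hence "x = y" using eq y by simp
      thus False using less by simp
    qed
    have "x \<ominus>\<^bsub>M\<^esub> y \<in> F (v x)"
      by (rule submodule_minus_closed[OF filtration, folded F_def])
        (use x y less in \<open>auto simp: F_def\<close>)
    hence le: "v x \<le> v (x \<ominus>\<^bsub>M\<^esub> y)" using ne by (simp add: F_def)
    have "\<not> v x < v (x \<ominus>\<^bsub>M\<^esub> y)"
    proof
      assume gt: "v x < v (x \<ominus>\<^bsub>M\<^esub> y)"
      define s where "s = min (v (x \<ominus>\<^bsub>M\<^esub> y)) (v y)"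
      have "x \<ominus>\<^bsub>M\<^esub> y \<in> F s" "y \<in> F s" using x y by (auto simp: F_def s_def)
      hence "x \<in> F s" using FE(5) eq by metis
      thus False using x gt less by (auto simp: F_def s_def min_le_iff_disj)
    qed
    with le ne show ?thesis by auto
  qed
  thus "x \<ominus>\<^bsub>M\<^esub> y \<noteq> \<zero>\<^bsub>M\<^esub>" "v (x \<ominus>\<^bsub>M\<^esub> y) = v x" by auto
qed

text \<open>\<open>trunc\<close> is what a conductor provides: modulo \<open>V\<close>, an element
  of \<open>U\<close> outside \<open>V\<close> can be given a value in the finite set
  \<open>W\<close> without lowering its value.\<close>

context
  fixes U V :: "'b set" and W :: "'s set"
  assumes U: "submodule U R M" and V: "submodule V R M" and VU: "V \<subseteq> U"
    and W: "finite W"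
    and trunc: "\<And>z. \<lbrakk>z \<in> U; z \<notin> V\<rbrakk> \<Longrightarrow> \<exists>j\<in>V. v (z \<ominus>\<^bsub>M\<^esub> j) \<in> W \<and> v z \<le> v (z \<ominus>\<^bsub>M\<^esub> j)"
begin

text \<open>Truncation cannot raise a value that is missing in \<open>V\<close>: otherwise
  \<open>j\<close>, as the difference of \<open>z\<close> and the truncated element, would be an
  element of \<open>V\<close> with the value of \<open>z\<close>.\<close>

lemma vals_diff_subset: "vals U - vals V \<subseteq> W"
proof
  fix s assume s: "s \<in> vals U - vals V"
  then obtain z where z: "z \<in> U" "z \<noteq> \<zero>\<^bsub>M\<^esub>" "s = v z" by (auto simp: vals_def)
  with s have "z \<notin> V" by (auto simp: vals_def)
  from trunc[OF z(1) this] obtain j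
    where j: "j \<in> V" "v (z \<ominus>\<^bsub>M\<^esub> j) \<in> W" "v z \<le> v (z \<ominus>\<^bsub>M\<^esub> j)" by auto
  have c: "z \<in> carrier M" "j \<in> carrier M"
    using z j submoduleE(1)[OF U] submoduleE(1)[OF V] by auto
  have "\<not> v z < v (z \<ominus>\<^bsub>M\<^esub> j)"
  proof
    assume less: "v z < v (z \<ominus>\<^bsub>M\<^esub> j)"
    have "z \<ominus>\<^bsub>M\<^esub> (z \<ominus>\<^bsub>M\<^esub> j) = j"
      using c by (metis M.minus_closed M.minus_eq M.a_assoc M.a_comm M.add.inv_closed
          M.minus_minus M.minus_add M.r_neg1)
    hence "j \<noteq> \<zero>\<^bsub>M\<^esub>" "v j = v z"
      using val_minus_eq[of z "z \<ominus>\<^bsub>M\<^esub> j"] c z less by auto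
    with j(1) have "s \<in> vals V" unfolding vals_def z(3) by (metis Diff_iff imageI singletonD)
    with s show False by simp
  qed
  with j z show "s \<in> W" by auto
qed

text \<open>Truncation modulo \<open>V\<close> and cancellation of the leading term by an element of
  \<open>N\<close> alternate. Each round raises the value strictly, and after a truncation only the
  finitely many values in \<open>W\<close> can occur.\<close>

lemma eq_if_vals_eq:
  assumes N: "submodule N R M" "V \<subseteq> N" and N': "submodule N' R M" "N \<subseteq> N'" "N' \<subseteq> U"
    and eq: "vals N' \<subseteq> vals N"
  shows "N' = N"
proof -
  have "z \<in> N" if "z \<in> N'" for z
    using that
  proof (induction "card {w \<in> W. v z \<le> w}" arbitrary: z rule: less_induct)
    case less
    show ?case
    proof (cases "z \<in> V")
      case True
      thus ?thesis using N by auto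
    next
      case False
      from trunc[OF _ this] less.prems N'(3) obtain j
        where j: "j \<in> V" "v (z \<ominus>\<^bsub>M\<^esub> j) \<in> W" "v z \<le> v (z \<ominus>\<^bsub>M\<^esub> j)" by auto
      define z1 where "z1 = z \<ominus>\<^bsub>M\<^esub> j"
      have c: "x \<in> carrier M" if "x \<in> N'" for x
        using that submoduleE(1)[OF N'(1)] by auto
      have jN: "j \<in> N" "j \<in> N'" using j N N' by auto
      have z1: "z1 \<in> N'"
        unfolding z1_def by (rule submodule_minus_closed[OF N'(1) less.prems jN(2)])
      have zz1: "z = z1 \<oplus>\<^bsub>M\<^esub> j"
        unfolding z1_def using minus_add_cancel c less.prems jN by simp
      have ne: "z1 \<noteq> \<zero>\<^bsub>M\<^esub>"
        using zz1 False j c jN by auto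
      with z1 eq have "v z1 \<in> vals N" by (auto simp: vals_def)
      then obtain y where y: "y \<in> N" "y \<noteq> \<zero>\<^bsub>M\<^esub>" "v z1 = v y" by (auto simp: vals_def)
      hence yN': "y \<in> N'" using N' by auto
      obtain a where a: "a \<in> carrier R"
        "z1 \<ominus>\<^bsub>M\<^esub> a \<odot>\<^bsub>M\<^esub> y = \<zero>\<^bsub>M\<^esub> \<or> v z1 < v (z1 \<ominus>\<^bsub>M\<^esub> a \<odot>\<^bsub>M\<^esub> y)"
        using leading[OF c[OF z1] c[OF yN'] ne y(2,3)] by auto
      define z2 where "z2 = z1 \<ominus>\<^bsub>M\<^esub> a \<odot>\<^bsub>M\<^esub> y"
      have ay: "a \<odot>\<^bsub>M\<^esub> y \<in> N" using submoduleE(4)[OF N(1)] a y by auto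
      hence ayN': "a \<odot>\<^bsub>M\<^esub> y \<in> N'" using N' by auto
      have z2: "z2 \<in> N'"
        unfolding z2_def by (rule submodule_minus_closed[OF N'(1) z1 ayN'])
      have z1z2: "z1 = z2 \<oplus>\<^bsub>M\<^esub> a \<odot>\<^bsub>M\<^esub> y"
        unfolding z2_def using minus_add_cancel[OF c[OF z1] c[OF ayN']] by simp
      have "z2 \<in> N"
      proof (cases "z2 = \<zero>\<^bsub>M\<^esub>")
        case True
        thus ?thesis using submodule_zero_closed[OF N(1)] by simp
      next
        case False
        hence "v z1 < v z2" using a by (simp add: z2_def)
        \<comment> \<open>The value of \<open>z1\<close> lies in \<open>W\<close> and is passed by
          \<open>z2\<close>, so the number of values still ahead drops.\<close>
        hence "v z1 \<in> {w \<in> W. v z \<le> w} - {w \<in> W. v z2 \<le> w}"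
          "{w \<in> W. v z2 \<le> w} \<subseteq> {w \<in> W. v z \<le> w}"
          using j by (auto simp flip: z1_def)
        hence "{w \<in> W. v z2 \<le> w} \<subset> {w \<in> W. v z \<le> w}"
          by blast
        hence "card {w \<in> W. v z2 \<le> w} < card {w \<in> W. v z \<le> w}"
          using W by (intro psubset_card_mono) auto
        from less.hyps[OF this z2] show ?thesis .
      qed
      thus ?thesis
        using zz1 z1z2 submoduleE(5)[OF N(1)] ay jN by auto
    qed
  qed
  with N' show ?thesis by auto
qed

text \<open>By \<open>eq_if_vals_eq\<close>, each strict inclusion adds a value that was not
  attained before.\<close>

lemma chain_length_le:
  assumes N: "\<forall>k\<le>n. submodule (N k) R M \<and> V \<subseteq> N k \<and> N k \<subseteq> U"
    and chain: "\<forall>k<n. N k \<subset> N (Suc k)"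
  shows "n \<le> card (vals U - vals V)"
proof -
  have fin: "finite (vals (N k) - vals V)" if "k \<le> n" for k
    using N that vals_mono[of "N k" U] vals_diff_subset W finite_subset
    by (metis Diff_mono subset_refl)
  have "k \<le> n \<Longrightarrow> k \<le> card (vals (N k) - vals V)" for k
  proof (induction k)
    case (Suc k)
    have 1: "submodule (N k) R M" "V \<subseteq> N k" "submodule (N (Suc k)) R M" "N (Suc k) \<subseteq> U"
      "N k \<subset> N (Suc k)"
      using N chain Suc.prems by auto
    have "\<not> vals (N (Suc k)) \<subseteq> vals (N k)"
      using eq_if_vals_eq[OF 1(1-3) _ 1(4)] 1(5) by auto
    hence "vals (N k) - vals V \<subset> vals (N (Suc k)) - vals V"
      using vals_mono[of "N k" "N (Suc k)"] vals_mono[OF 1(2)] 1(5) by blast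
    from psubset_card_mono[OF fin[OF Suc.prems] this] Suc show ?case by simp
  qed auto
  from this[of n] have "n \<le> card (vals (N n) - vals V)" by simp
  also have "\<dots> \<le> card (vals U - vals V)"
    using vals_mono[of "N n" U] N vals_diff_subset W
    by (intro card_mono) (auto intro: finite_subset)
  finally show ?thesis .
qed

text \<open>The missing values are added one at a time, from the largest down: to \<open>V\<close>
  one adds the elements of \<open>U\<close> whose value is at least the \<open>k\<close>-th largest
  missing one.\<close>

lemma ex_chain:
  "\<exists>N :: nat \<Rightarrow> 'b set.
     (\<forall>k\<le>card (vals U - vals V). submodule (N k) R M \<and> V \<subseteq> N k \<and> N k \<subseteq> U) \<and>
     (\<forall>k<card (vals U - vals V). N k \<subset> N (Suc k))"
proof -
  define n where "n = card (vals U - vals V)"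
  define ws where "ws = sorted_list_of_set (vals U - vals V)"
  have fin: "finite (vals U - vals V)"
    using vals_diff_subset W by (rule finite_subset)
  have len: "length ws = n" and set_ws: "set ws = vals U - vals V"
    using fin by (auto simp: ws_def n_def)
  have lt: "ws ! i < ws ! k" if "i < k" "k < n" for i k
    using that fin len
    by (metis strict_sorted_list_of_set sorted_wrt_nth_less ws_def)
  \<comment> \<open>Since \<open>ws\<close> is increasing, the entry at \<open>n - k\<close> is the
    \<open>k\<close>-th largest. For \<open>k = 0\<close> the index would lie past the end; the zero
    submodule makes the chain start at \<open>V\<close>.\<close>
  define F where "F k = (if k = 0 then {\<zero>\<^bsub>M\<^esub>}
    else {z \<in> carrier M. z = \<zero>\<^bsub>M\<^esub> \<or> ws ! (n - k) \<le> v z})" for k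
  have F: "submodule (F k) R M" for k
  proof (cases "k = 0")
    case True
    thus ?thesis unfolding F_def by (auto intro!: submoduleI)
  qed (simp add: F_def filtration)
  define N where "N k = V <+>\<^bsub>M\<^esub> (U \<inter> F k)" for k
  have UF: "submodule (U \<inter> F k) R M" for k by (rule submodule_Int[OF U F])
  have c: "x \<in> carrier M" if "x \<in> U" for x
    using that submoduleE(1)[OF U] by auto
  have N: "submodule (N k) R M \<and> V \<subseteq> N k \<and> N k \<subseteq> U" for k
  proof (intro conjI subsetI)
    show "submodule (N k) R M"
      unfolding N_def by (rule submodule_set_add[OF V UF])
    fix x
    show "x \<in> N k" if "x \<in> V"
    proof -
      have "x = x \<oplus>\<^bsub>M\<^esub> \<zero>\<^bsub>M\<^esub>" using that c VU by auto
      thus ?thesis using that submodule_zero_closed[OF UF[of k]]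
        unfolding N_def set_add_def' by blast
    qed
    show "x \<in> U" if "x \<in> N k"
      using that VU submoduleE(5)[OF U] unfolding N_def set_add_def' by blast
  qed
  have "N k \<subset> N (Suc k)" if k: "k < n" for k
  proof -
    have "F k \<subseteq> F (Suc k)"
    proof (cases "k = 0")
      case False
      hence "ws ! (n - Suc k) < ws ! (n - k)" using k by (intro lt) auto
      thus ?thesis using False by (auto simp: F_def)
    qed (auto simp: F_def)
    hence sub: "N k \<subseteq> N (Suc k)" unfolding N_def set_add_def' by blast
    define w where "w = ws ! (n - Suc k)"
    have w: "w \<in> vals U" "w \<notin> vals V"
      using nth_mem[of "n - Suc k" ws] k len set_ws by (auto simp: w_def)
    then obtain z where z: "z \<in> U" "z \<noteq> \<zero>\<^bsub>M\<^esub>" "w = v z" by (auto simp: vals_def)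
    have "z \<in> F (Suc k)" using z c by (auto simp: F_def simp flip: w_def)
    moreover have "z = \<zero>\<^bsub>M\<^esub> \<oplus>\<^bsub>M\<^esub> z" using z c by simp
    ultimately have "z \<in> N (Suc k)"
      using z submodule_zero_closed[OF V] unfolding N_def set_add_def' by blast
    \<comment> \<open>If \<open>z\<close> were \<open>j\<close> plus some \<open>f\<close> that is
      zero or of larger value, then \<open>j\<close> would have the value of \<open>z\<close>, which
      is missing in \<open>V\<close>.\<close>
    moreover have "z \<notin> N k"
    proof
      assume "z \<in> N k"
      then obtain j f where jf: "z = j \<oplus>\<^bsub>M\<^esub> f" "j \<in> V" "f \<in> U" "f \<in> F k"
        by (auto simp: N_def set_add_def')
      have cj: "j \<in> carrier M" "f \<in> carrier M" using jf VU c by auto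
      have j: "j = z \<ominus>\<^bsub>M\<^esub> f"
        using jf cj by (simp add: a_minus_def M.a_assoc M.r_neg)
      have "f = \<zero>\<^bsub>M\<^esub> \<or> v z < v f"
      proof (cases "k = 0")
        case True
        thus ?thesis using jf by (simp add: F_def)
      next
        case False
        hence "ws ! (n - Suc k) < ws ! (n - k)" using k by (intro lt) auto
        with False jf(4) z show ?thesis by (auto simp: F_def simp flip: w_def)
      qed
      from val_minus_eq[OF c[OF z(1)] z(2) cj(2) this] j
      have "j \<noteq> \<zero>\<^bsub>M\<^esub>" "v j = w" using z by auto
      with jf w show False by (auto simp: vals_def)
    qed
    ultimately show ?thesis using sub by auto
  qed
  with N show ?thesis unfolding n_def by blast
qed

theorem quot_length_eq_card_vals:
  "quot_length R M U V = enat (card (vals U - vals V))"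
  unfolding quot_length_eq[OF module_axioms U V VU]
proof (rule antisym)
  show "Sup {enat n |n. \<exists>N. (\<forall>k\<le>n. submodule (N k) R M \<and> V \<subseteq> N k \<and> N k \<subseteq> U) \<and>
      (\<forall>k<n. N k \<subset> N (Suc k))} \<le> enat (card (vals U - vals V))"
    by (rule Sup_least) (use chain_length_le in auto)
  show "enat (card (vals U - vals V)) \<le> Sup {enat n |n. \<exists>N.
      (\<forall>k\<le>n. submodule (N k) R M \<and> V \<subseteq> N k \<and> N k \<subseteq> U) \<and> (\<forall>k<n. N k \<subset> N (Suc k))}"
    by (rule Sup_upper) (use ex_chain in blast)
qed

end

end

section \<open>Minimal primes\<close>

text \<open>An ideal maximal among those that avoid the multiplicative set of all \<open>a g\<^sup>k\<close> with
  \<open>a \<notin> P\<close> is prime and contained in \<open>P\<close>.\<close>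

lemma (in cring) regular_element_notin_minimal_prime:
  assumes P: "P \<in> minimal_primes R" and g: "regular_element R g"
  shows "g \<notin> P"
proof
  assume gP: "g \<in> P"
  interpret P: primeideal P R using P by (simp add: minimal_primes_def)
  have gc: "g \<in> carrier R" using g by (simp add: regular_element_def)
  define S where "S = {a \<otimes> g [^] k | a k. a \<in> carrier R - P \<and> (k :: nat) \<in> UNIV}"
  have Sc: "s \<in> carrier R" if "s \<in> S" for s using that gc by (auto simp: S_def)
  have S_mult: "s \<otimes> s' \<in> S" if ss: "s \<in> S" "s' \<in> S" for s s'
  proof -
    obtain a k b m where *: "s = a \<otimes> g [^] (k :: nat)" "a \<in> carrier R - P"
      "s' = b \<otimes> g [^] (m :: nat)" "b \<in> carrier R - P"
      using ss by (auto simp: S_def)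
    have "s \<otimes> s' = (a \<otimes> b) \<otimes> g [^] (k + m)"
      using * gc by (simp add: nat_pow_mult[symmetric] m_ac)
    moreover have "a \<otimes> b \<in> carrier R - P" using * P.I_prime by auto
    ultimately show ?thesis unfolding S_def by blast
  qed
  have PS: "a \<in> S" if "a \<in> carrier R" "a \<notin> P" for a
    unfolding S_def using that by (intro CollectI exI[of _ a] exI[of _ "0::nat"]) auto
  have one_notin: "\<one> \<notin> P" using P.one_imp_carrier P.I_notcarr by auto
  have gS: "g \<in> S"
    unfolding S_def using gc one_notin by (intro CollectI exI[of _ \<one>] exI[of _ "1::nat"]) auto
  \<comment> \<open>Powers of a regular element are regular. This keeps zero out of
    \<open>S\<close>, so that the zero ideal is available for Zorn's lemma.\<close>
  have reg: "x = \<zero>" if "x \<in> carrier R" "x \<otimes> g [^] (k :: nat) = \<zero>" for x k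
    using that
  proof (induction k)
    case (Suc k)
    have "g \<otimes> (x \<otimes> g [^] k) = \<zero>" using Suc.prems gc by (simp add: m_ac)
    hence "x \<otimes> g [^] k = \<zero>" using g Suc.prems gc by (auto simp: regular_element_def)
    with Suc show ?case by simp
  qed simp
  have zero: "\<zero> \<notin> S"
  proof
    assume "\<zero> \<in> S"
    then obtain a k where "a \<in> carrier R - P" "a \<otimes> g [^] (k :: nat) = \<zero>"
      by (auto simp: S_def)
    thus False using reg[of a k] P.zero_closed by auto
  qed
  define \<F> where "\<F> = {Q. ideal Q R \<and> Q \<inter> S = {}}"
  have "\<exists>Q\<in>\<F>. \<forall>Q'\<in>\<F>. Q \<subseteq> Q' \<longrightarrow> Q' = Q"
  proof (rule subset_Zorn)
    fix C assume C: "subset.chain \<F> C"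
    show "\<exists>U\<in>\<F>. \<forall>Q\<in>C. Q \<subseteq> U"
    proof (cases "C = {}")
      case True
      thus ?thesis using zero zeroideal by (auto simp: \<F>_def)
    next
      case False
      have "subset.chain {Q. ideal Q R} C" using C by (auto simp: subset_chain_def \<F>_def)
      hence "ideal (\<Union>C) R" using chain_Union_is_ideal[of C] False by simp
      moreover have "\<Union>C \<inter> S = {}" using C by (auto simp: subset_chain_def \<F>_def)
      ultimately show ?thesis by (intro bexI[of _ "\<Union>C"]) (auto simp: \<F>_def)
    qed
  qed
  then obtain Q where Q: "ideal Q R" "Q \<inter> S = {}"
    and max: "\<And>Q'. \<lbrakk>ideal Q' R; Q' \<inter> S = {}; Q \<subseteq> Q'\<rbrakk> \<Longrightarrow> Q' = Q"
    by (auto simp: \<F>_def)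
  interpret Q: ideal Q R by fact
  have meets: "\<exists>q\<in>Q. \<exists>r\<in>carrier R. q \<oplus> r \<otimes> a \<in> S" if a: "a \<in> carrier R" "a \<notin> Q" for a
  proof -
    have id: "ideal (Q <+>\<^bsub>R\<^esub> PIdl a) R" by (rule add_ideals[OF Q(1) cgenideal_ideal[OF a(1)]])
    have "q \<in> Q <+>\<^bsub>R\<^esub> PIdl a" if "q \<in> Q" for q
    proof -
      have "q = q \<oplus> \<zero> \<otimes> a" using that a Q.Icarr by simp
      thus ?thesis using that unfolding set_add_def' cgenideal_def by blast
    qed
    moreover have "a \<in> Q <+>\<^bsub>R\<^esub> PIdl a"
    proof -
      have "a = \<zero> \<oplus> \<one> \<otimes> a" using a by simp
      thus ?thesis using Q.zero_closed unfolding set_add_def' cgenideal_def by blast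
    qed
    ultimately have "(Q <+>\<^bsub>R\<^esub> PIdl a) \<inter> S \<noteq> {}" using max[OF id] a by blast
    thus ?thesis unfolding set_add_def' cgenideal_def by blast
  qed
  have "primeideal Q R"
  proof (rule primeidealI[OF Q(1) is_cring])
    show "carrier R \<noteq> Q" using gS gc Q by auto
    fix a b assume ab: "a \<in> carrier R" "b \<in> carrier R" "a \<otimes> b \<in> Q"
    show "a \<in> Q \<or> b \<in> Q"
    proof (rule ccontr)
      assume "\<not> (a \<in> Q \<or> b \<in> Q)"
      then obtain p r q s where *: "p \<in> Q" "r \<in> carrier R" "p \<oplus> r \<otimes> a \<in> S"
        "q \<in> Q" "s \<in> carrier R" "q \<oplus> s \<otimes> b \<in> S"
        using meets ab by metis
      have "(p \<oplus> r \<otimes> a) \<otimes> (q \<oplus> s \<otimes> b) =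
          p \<otimes> (q \<oplus> s \<otimes> b) \<oplus> ((r \<otimes> a) \<otimes> q \<oplus> (r \<otimes> s) \<otimes> (a \<otimes> b))"
        using * ab Q.Icarr by (simp add: l_distr r_distr a_ac m_ac)
      also have "\<dots> \<in> Q"
        using * ab Q.Icarr by (intro Q.a_closed) (auto intro: Q.I_l_closed Q.I_r_closed)
      finally show False using S_mult[OF *(3,6)] Q by auto
    qed
  qed
  \<comment> \<open>\<open>S\<close> contains the complement of \<open>P\<close>, so
    \<open>Q\<close> lies in \<open>P\<close>, and minimality gives equality; but \<open>g\<close>
    lies both in \<open>P\<close> and in \<open>S\<close>.\<close>
  moreover have "Q \<subseteq> P" using PS Q Q.Icarr by blast
  ultimately have "Q = P" using P by (auto simp: minimal_primes_def)
  with gP gS Q show False by auto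
qed

text \<open>One takes the product of elements chosen in each \<open>Q l\<close> outside
  \<open>P\<close>. It lies in every \<open>Q l\<close>, and primality keeps it outside
  \<open>P\<close>.\<close>

lemma (in cring) ex_separating_element:
  assumes "finite L" "primeideal P R" "\<And>l. l \<in> L \<Longrightarrow> ideal (Q l) R \<and> \<not> Q l \<subseteq> P"
  shows "\<exists>h\<in>carrier R. h \<notin> P \<and> (\<forall>l\<in>L. h \<in> Q l)"
  using assms(1,3)
proof (induction L)
  case empty
  interpret P: primeideal P R by fact
  show ?case using P.one_imp_carrier P.I_notcarr by auto
next
  case (insert l L)
  interpret P: primeideal P R by fact
  interpret Q: ideal "Q l" R using insert by auto
  obtain h where h: "h \<in> carrier R" "h \<notin> P" "\<forall>l\<in>L. h \<in> Q l" using insert by auto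
  obtain q where q: "q \<in> Q l" "q \<notin> P" using insert.prems by blast
  have "h \<otimes> q \<in> Q k" if "k \<in> L" for k
    using h that insert.prems[of k] q Q.Icarr by (auto intro: ideal.I_r_closed)
  moreover have "h \<otimes> q \<in> Q l" using h q by (auto intro: Q.I_l_closed)
  moreover have "h \<otimes> q \<notin> P" using h q P.I_prime Q.Icarr by blast
  ultimately show ?case using h q Q.Icarr by (intro bexI[of _ "h \<otimes> q"]) auto
qed

section \<open>Substitution into a power series in one variable\<close>

text \<open>For \<open>x\<close> without constant term, this is \<open>h(x) = h\<^sub>0 + x h'(x)\<close>, where \<open>h'\<close> is the series of
  the shifted coefficients.\<close>

function mps_subst ::
  "('n::finite, 'k::comm_ring_1) mps \<Rightarrow> (nat \<Rightarrow> 'k) \<Rightarrow> ('n, 'k) mps" where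
  "mps_subst x h m = mps_const (h 0) m +
     (\<Sum>a\<in>{..m} - {\<lambda>_. 0}. x a * mps_subst x (\<lambda>k. h (Suc k)) (\<lambda>j. m j - a j))"
  by pat_completeness auto
termination
\<comment> \<open>The exponent zero is excluded from the sum, so each recursive call has an exponent
  of smaller total degree.\<close>
proof (relation "measure (\<lambda>(x, h, m). \<Sum>j\<in>UNIV. m j)", goal_cases)
  case (2 x h m a)
  hence le: "a j \<le> m j" for j by (auto simp: le_fun_def)
  obtain j where "a j \<noteq> 0" using 2 by (auto simp: fun_eq_iff)
  hence "\<exists>j\<in>UNIV. m j - a j < m j" using le[of j] by (intro bexI[of _ j]) auto
  hence "(\<Sum>j\<in>UNIV. m j - a j) < (\<Sum>j\<in>UNIV. m j)"
    by (intro sum_strict_mono_ex1) auto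
  thus ?case by simp
qed auto

declare mps_subst.simps [simp del]

text \<open>The summand for the exponent zero, left out of the recursion to make it terminate,
  vanishes when \<open>x\<close> has no constant term.\<close>

lemma mps_subst_eq:
  assumes "x (\<lambda>_. 0) = 0"
  shows "mps_subst x h =
    mps_const (h 0) \<oplus>\<^bsub>mps_ring\<^esub> x \<otimes>\<^bsub>mps_ring\<^esub> mps_subst x (\<lambda>k. h (Suc k))"
proof
  fix m
  have "(\<Sum>a\<in>{..m}. x a * mps_subst x (\<lambda>k. h (Suc k)) (\<lambda>j. m j - a j)) =
      (\<Sum>a\<in>{..m} - {\<lambda>_. 0}. x a * mps_subst x (\<lambda>k. h (Suc k)) (\<lambda>j. m j - a j))"
    using assms by (intro sum.mono_neutral_right finite_atMost_exponent) auto
  thus "mps_subst x h m =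
    (mps_const (h 0) \<oplus>\<^bsub>mps_ring\<^esub> x \<otimes>\<^bsub>mps_ring\<^esub> mps_subst x (\<lambda>k. h (Suc k))) m"
    by (subst mps_subst.simps) (simp add: mps_ring_def)
qed

section \<open>Power series over a subring of power series\<close>

text \<open>Iterated division with remainder by \<open>y\<close>. The statement is a congruence modulo every power of
  \<open>y\<close>, which spares the composition of power series.\<close>

lemma fps_expansion_in_powers:
  fixes y f :: "'k::field fps"
  assumes y: "y \<noteq> 0"
  shows "\<exists>H. \<forall>N. y ^ N dvd
    f - (\<Sum>j<subdegree y. (\<Sum>q<N. fps_const (H j q) * y ^ q) * fps_X ^ j)"
proof -
  define e where "e = subdegree y"
  define u where "u = fps_shift e y"
  have u: "u $ 0 \<noteq> 0" using y by (simp add: u_def e_def)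
  have y_eq: "y = u * fps_X ^ e" unfolding u_def e_def by (rule subdegree_decompose)
  \<comment> \<open>\<open>r (Suc N)\<close> is the quotient in the division of \<open>r N\<close>
    by \<open>y\<close>; the remainder consists of the first \<open>e\<close> coefficients of
    \<open>r N\<close>.\<close>
  define r where "r = rec_nat f (\<lambda>_ g. inverse u * fps_shift e g)"
  have r0: "r 0 = f" and rS: "r (Suc N) = inverse u * fps_shift e (r N)" for N
    by (simp_all add: r_def)
  have step: "r N = (\<Sum>j<e. fps_const (r N $ j) * fps_X ^ j) + y * r (Suc N)" for N
  proof -
    have "y * r (Suc N) = (u * inverse u) * (fps_shift e (r N) * fps_X ^ e)"
      by (simp add: y_eq rS mult_ac)
    also have "\<dots> = fps_shift e (r N) * fps_X ^ e"
      using u by (simp add: inverse_mult_eq_1')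
    finally have 1: "y * r (Suc N) = fps_shift e (r N) * fps_X ^ e" .
    have 2: "fps_cutoff e (r N) = (\<Sum>j<e. fps_const (r N $ j) * fps_X ^ j)"
      by (rule fps_ext) (simp add: fps_sum_nth fps_X_power_nth if_distrib cong: if_cong)
    show ?thesis
      using fps_shift_cutoff[of e "r N"] by (simp add: 1 2 add.commute)
  qed
  have "f = (\<Sum>j<e. (\<Sum>q<N. fps_const (r q $ j) * y ^ q) * fps_X ^ j) + y ^ N * r N" for N
  proof (induction N)
    case (Suc N)
    have "f = (\<Sum>j<e. (\<Sum>q<N. fps_const (r q $ j) * y ^ q) * fps_X ^ j) +
        y ^ N * ((\<Sum>j<e. fps_const (r N $ j) * fps_X ^ j) + y * r (Suc N))"
      using Suc step by metis
    also have "\<dots> = (\<Sum>j<e. (\<Sum>q<Suc N. fps_const (r q $ j) * y ^ q) * fps_X ^ j) +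
        y ^ Suc N * r (Suc N)"
      by (simp add: algebra_simps sum.distrib sum_distrib_left)
    finally show ?case .
  qed (simp add: r0)
  hence "f - (\<Sum>j<e. (\<Sum>q<N. fps_const (r q $ j) * y ^ q) * fps_X ^ j) = y ^ N * r N" for N
    unfolding diff_eq_eq by (rule trans[OF _ add.commute])
  thus ?thesis
    unfolding e_def by (intro exI[of _ "\<lambda>j q. r q $ j"]) (auto intro: dvdI)
qed

text \<open>A nonzero \<open>f\<close> of order \<open>n\<close> has no divisor
  \<open>y ^ Suc n\<close>, since the order of that power is at least \<open>Suc n\<close>.\<close>

lemma fps_eq_0_if_power_dvd:
  fixes y f :: "'k::field fps"
  assumes "0 < subdegree y" and "\<And>N. y ^ N dvd f"
  shows "f = 0"
proof (rule ccontr)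
  assume f: "f \<noteq> 0"
  define n where "n = subdegree f"
  obtain g where g: "f = y ^ Suc n * g" using assms(2)[of "Suc n"] by (elim dvdE)
  have "subdegree (y ^ Suc n * g) = Suc n * subdegree y + subdegree g"
    using f g by (subst subdegree_mult) (auto simp del: power_Suc)
  hence "n = Suc n * subdegree y + subdegree g" unfolding g[symmetric] unfolding n_def .
  moreover have "Suc n \<le> Suc n * subdegree y"
    using assms(1) mult_le_mono2[of 1 "subdegree y" "Suc n"] by simp
  ultimately show False by linarith
qed

section \<open>The conductor of a reduced algebroid curve\<close>

locale algebroid_curve =
  fixes C :: "('n::finite, 'k::alg_closed_field) curve"
  assumes reduced: "reduced_algebroid_curve C"
begin

abbreviation "\<O> \<equiv> curve_ring C"

definition coord :: "nat \<Rightarrow> ('n, 'k) mps set \<Rightarrow> 'k fls" where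
  "coord i x = branch_embed C i (curve_to_branch C i x)"

definition of_series :: "('n, 'k) mps \<Rightarrow> ('n, 'k) mps set" where
  "of_series f = defining_ideal C +>\<^bsub>mps_ring\<^esub> f"

lemma ideal_defining: "ideal (defining_ideal C) mps_ring"
  using reduced by (simp add: reduced_algebroid_curve_def)

sublocale cring \<O>
  unfolding curve_ring_def by (rule ideal.quotient_is_cring[OF ideal_defining cring_mps_ring])

lemma branch_prime_minimal: "i \<in> branches C \<Longrightarrow> branch_prime C i \<in> minimal_primes \<O>"
  using reduced by (auto simp: reduced_algebroid_curve_def bij_betw_def)

lemma branch_prime_primeideal: "i \<in> branches C \<Longrightarrow> primeideal (branch_prime C i) \<O>"
  using branch_prime_minimal by (auto simp: minimal_primes_def)

lemma branch_prime_not_subset: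
  assumes "i \<in> branches C" "l \<in> branches C" "l \<noteq> i"
  shows "\<not> branch_prime C l \<subseteq> branch_prime C i"
proof
  assume "branch_prime C l \<subseteq> branch_prime C i"
  hence "branch_prime C l = branch_prime C i"
    using branch_prime_minimal[OF assms(1)] branch_prime_primeideal[OF assms(2)]
    by (auto simp: minimal_primes_def)
  moreover have "inj_on (branch_prime C) (branches C)"
    using reduced by (simp add: reduced_algebroid_curve_def bij_betw_def)
  ultimately show False using assms by (auto dest: inj_onD)
qed

lemma cring_branch_ring: "i \<in> branches C \<Longrightarrow> cring (branch_ring C i)"
  unfolding branch_ring_def
  by (rule ideal.quotient_is_cring[OF primeideal.axioms(1)[OF branch_prime_primeideal] is_cring])

lemma branch_normalization: "i \<in> branches C \<Longrightarrow> branch_normalization C i (branch_embed C i)"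
  using reduced by (simp add: reduced_algebroid_curve_def)

lemma of_series_hom: "of_series \<in> ring_hom mps_ring \<O>"
  unfolding curve_ring_def of_series_def[abs_def] by (rule ideal.rcos_ring_hom[OF ideal_defining])

lemma of_series_closed [simp]: "of_series f \<in> carrier \<O>"
  using ring_hom_closed[OF of_series_hom] by (simp add: mps_ring_def)

lemma of_series_add: "of_series (f \<oplus>\<^bsub>mps_ring\<^esub> g) = of_series f \<oplus>\<^bsub>\<O>\<^esub> of_series g"
  using ring_hom_add[OF of_series_hom] by (simp add: mps_ring_def)

lemma of_series_mult: "of_series (f \<otimes>\<^bsub>mps_ring\<^esub> g) = of_series f \<otimes>\<^bsub>\<O>\<^esub> of_series g"
  using ring_hom_mult[OF of_series_hom] by (simp add: mps_ring_def)

lemma of_series_surj: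
  assumes "x \<in> carrier \<O>"
  obtains f where "x = of_series f"
  using assms by (auto simp: curve_ring_def FactRing_def A_RCOSETS_def' of_series_def)

lemma curve_const_eq: "curve_const C c = of_series (mps_const c)"
  by (simp add: curve_const_def of_series_def)

lemma curve_to_branch_hom:
  "i \<in> branches C \<Longrightarrow> curve_to_branch C i \<in> ring_hom \<O> (branch_ring C i)"
  unfolding branch_ring_def curve_to_branch_def[abs_def]
  by (rule ideal.rcos_ring_hom[OF primeideal.axioms(1)[OF branch_prime_primeideal]])

lemma curve_to_branch_surj:
  assumes "a \<in> carrier (branch_ring C i)"
  obtains x where "x \<in> carrier \<O>" "a = curve_to_branch C i x"
  using assms by (auto simp: branch_ring_def FactRing_def A_RCOSETS_def' curve_to_branch_def)

section \<open>The coordinate of the curve ring on one branch\<close>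

context
  fixes i assumes i: "i \<in> branches C"
begin

lemma embed_hom: "branch_embed C i \<in> ring_hom (branch_ring C i) ring_of_type_algebra"
  using branch_normalization[OF i] by (simp add: branch_normalization_def)

lemma coord_hom: "coord i \<in> ring_hom \<O> ring_of_type_algebra"
  using ring_hom_trans[OF curve_to_branch_hom[OF i] embed_hom] by (simp add: coord_def[abs_def] o_def)

lemma coord_add: "\<lbrakk>x \<in> carrier \<O>; y \<in> carrier \<O>\<rbrakk> \<Longrightarrow> coord i (x \<oplus>\<^bsub>\<O>\<^esub> y) = coord i x + coord i y"
  using ring_hom_add[OF coord_hom] by (simp add: ring_of_type_algebra_def)

lemma coord_mult: "\<lbrakk>x \<in> carrier \<O>; y \<in> carrier \<O>\<rbrakk> \<Longrightarrow> coord i (x \<otimes>\<^bsub>\<O>\<^esub> y) = coord i x * coord i y"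
  using ring_hom_mult[OF coord_hom] by (simp add: ring_of_type_algebra_def)

lemma coord_one: "coord i \<one>\<^bsub>\<O>\<^esub> = 1"
  using ring_hom_one[OF coord_hom] by (simp add: ring_of_type_algebra_def)

lemma coord_zero: "coord i \<zero>\<^bsub>\<O>\<^esub> = 0"
  by (metis add_cancel_left_left coord_add l_zero zero_closed)

lemma coord_const: "coord i (of_series (mps_const c)) = fls_const c"
  using branch_normalization[OF i]
  by (simp add: branch_normalization_def coord_def curve_const_eq)

text \<open>The embedding of the branch ring is injective, so only the quotient map contributes to
  the kernel of \<open>coord i\<close>.\<close>

lemma coord_eq_0_iff:
  assumes "x \<in> carrier \<O>"
  shows "coord i x = 0 \<longleftrightarrow> x \<in> branch_prime C i"
proof -
  interpret P: primeideal "branch_prime C i" \<O> by (rule branch_prime_primeideal[OF i])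
  have inj: "inj_on (branch_embed C i) (carrier (branch_ring C i))"
    using branch_normalization[OF i] by (simp add: branch_normalization_def)
  have cl: "curve_to_branch C i z \<in> carrier (branch_ring C i)" if "z \<in> carrier \<O>" for z
    using ring_hom_closed[OF curve_to_branch_hom[OF i] that] .
  have "coord i x = 0 \<longleftrightarrow> branch_embed C i (curve_to_branch C i x) =
      branch_embed C i (curve_to_branch C i \<zero>\<^bsub>\<O>\<^esub>)"
    using coord_zero by (simp add: coord_def)
  also have "\<dots> \<longleftrightarrow> curve_to_branch C i x = curve_to_branch C i \<zero>\<^bsub>\<O>\<^esub>"
    using inj_on_eq_iff[OF inj cl[OF assms] cl[OF zero_closed]] .
  also have "\<dots> \<longleftrightarrow> x \<in> branch_prime C i"
    using P.rcos_const_imp_mem[OF assms] P.a_rcos_const[of x] P.a_rcos_const[OF P.zero_closed]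
    by (auto simp: curve_to_branch_def)
  finally show ?thesis .
qed

text \<open>An element \<open>a\<close> of the image of the branch ring is a root of the monic
  polynomial \<open>X - a\<close>, hence integral, and the integral closure is K[[t]].\<close>

lemma coord_integral:
  assumes x: "x \<in> carrier \<O>"
  shows "coord i x \<in> range fps_to_fls"
proof -
  define S where "S = branch_embed C i ` carrier (branch_ring C i)"
  have S: "coord i z \<in> S" if "z \<in> carrier \<O>" for z
    using ring_hom_closed[OF curve_to_branch_hom[OF i] that] by (auto simp: S_def coord_def)
  have "- coord i x = coord i (of_series (mps_const (- 1)) \<otimes>\<^bsub>\<O>\<^esub> x)"
    using x by (simp add: coord_mult coord_const)
  hence "- coord i x \<in> S" using S x by (metis m_closed of_series_closed)
  moreover have "0 \<in> S" "1 \<in> S"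
    using S[OF zero_closed] S[OF one_closed] by (simp_all add: coord_zero coord_one)
  ultimately have "coord i x \<in> integral_closure S"
    unfolding integral_closure_def
    by (intro CollectI exI[of _ "[:- coord i x, 1:]"]) (auto simp: coeff_pCons split: nat.splits)
  also have "integral_closure S = range fps_to_fls"
    using branch_normalization[OF i] by (simp add: branch_normalization_def S_def)
  finally show ?thesis .
qed

lemma coord_fraction:
  obtains a b where "a \<in> carrier \<O>" "b \<in> carrier \<O>" "coord i b \<noteq> 0" "f = coord i a / coord i b"
proof -
  obtain a b where ab: "a \<in> carrier (branch_ring C i)" "b \<in> carrier (branch_ring C i)"
    "branch_embed C i b \<noteq> 0" "f = branch_embed C i a / branch_embed C i b"
    using branch_normalization[OF i] unfolding branch_normalization_def by blast
  obtain x where x: "x \<in> carrier \<O>" "a = curve_to_branch C i x"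
    using ab(1) by (rule curve_to_branch_surj)
  obtain y where y: "y \<in> carrier \<O>" "b = curve_to_branch C i y"
    using ab(2) by (rule curve_to_branch_surj)
  show ?thesis
    by (rule that[OF x(1) y(1)]) (use ab x y in \<open>simp_all add: coord_def\<close>)
qed

text \<open>By \<open>coord_integral\<close>, \<open>fls_regpart\<close> loses nothing here. The
  passage to power series matters for divisibility, which says nothing in the field of Laurent
  series.\<close>

definition series_coord :: "('n, 'k) mps \<Rightarrow> 'k fps" where
  "series_coord f = fls_regpart (coord i (of_series f))"

lemma fps_to_fls_series_coord: "fps_to_fls (series_coord f) = coord i (of_series f)"
  using coord_integral[OF of_series_closed, of f] by (auto simp: series_coord_def)

lemma series_coord_add:
  "series_coord (f \<oplus>\<^bsub>mps_ring\<^esub> g) = series_coord f + series_coord g"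
  by (simp add: of_series_add coord_add fps_to_fls_series_coord
      flip: fps_to_fls_eq_iff)

lemma series_coord_mult:
  "series_coord (f \<otimes>\<^bsub>mps_ring\<^esub> g) = series_coord f * series_coord g"
  by (simp add: of_series_mult coord_mult fps_to_fls_series_coord fls_times_fps_to_fls
      flip: fps_to_fls_eq_iff)

lemma series_coord_const: "series_coord (mps_const c) = fps_const c"
  by (simp add: series_coord_def coord_const)

text \<open>Applying \<open>mps_subst_eq\<close> \<open>N\<close> times gives a partial sum with an
  explicit remainder. Divisibility of the remainder takes the place of convergence.\<close>

lemma series_coord_subst:
  assumes "x (\<lambda>_. 0) = 0"
  shows "series_coord (mps_subst x h) =
    (\<Sum>q<N. fps_const (h q) * series_coord x ^ q) +
    series_coord x ^ N * series_coord (mps_subst x (\<lambda>k. h (k + N)))"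
proof (induction N)
  case (Suc N)
  have "series_coord (mps_subst x (\<lambda>k. h (k + N))) =
      fps_const (h N) + series_coord x * series_coord (mps_subst x (\<lambda>k. h (k + Suc N)))"
    by (subst mps_subst_eq[of x, OF assms]) (simp add: series_coord_add series_coord_mult series_coord_const)
  with Suc show ?case by (simp add: algebra_simps)
qed simp

text \<open>A series with nonzero constant term is invertible, hence stays a unit in \<open>K[[t]]\<close>.\<close>

lemma constant_term_eq_0_if_subdegree_pos:
  assumes "0 < subdegree (series_coord x)"
  shows "x (\<lambda>_. 0) = 0"
proof (rule ccontr)
  assume c: "x (\<lambda>_. 0) \<noteq> 0"
  define c where "c = x (\<lambda>_. 0)"
  \<comment> \<open>\<open>y\<close> is \<open>1 - x / c\<close>, which has no constant term, so the
    geometric series in \<open>y\<close> inverts \<open>x / c\<close>. Its image would invert a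
    power series of positive order.\<close>
  define y where "y = mps_const 1 \<oplus>\<^bsub>mps_ring\<^esub> mps_const (- (1 / c)) \<otimes>\<^bsub>mps_ring\<^esub> x"
  have y0: "y (\<lambda>_. 0) = 0"
  proof -
    have "{..(\<lambda>_. 0) :: 'n \<Rightarrow> nat} = {\<lambda>_. 0}" by (auto simp: le_fun_def fun_eq_iff)
    thus ?thesis using c by (simp add: y_def mps_ring_def mps_const_def c_def)
  qed
  define p s where "p = fps_const (1 / c) * series_coord x"
    and "s = series_coord (mps_subst y (\<lambda>_. 1))"
  have y: "series_coord y = 1 - p"
    by (simp add: y_def p_def series_coord_add series_coord_mult series_coord_const
        flip: fps_const_neg)
  have "s = 1 + (1 - p) * s"
    using series_coord_subst[of y "\<lambda>_. 1" 1, OF y0] by (simp add: s_def y)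
  hence "s - (1 - p) * s = 1"
    unfolding diff_eq_eq .
  hence "p * s = 1"
    by (simp add: algebra_simps)
  hence "(p * s) $ 0 = 1"
    by simp
  thus False using nth_less_subdegree_zero[OF assms] by (simp add: p_def)
qed

text \<open>The uniformizer t is a fraction of elements of the branch ring, and its numerator has
  order one more than its denominator.\<close>

lemma ex_series_subdegree_pos: "\<exists>x. 0 < subdegree (series_coord x)"
proof -
  obtain a b where ab: "a \<in> carrier \<O>" "b \<in> carrier \<O>" "coord i b \<noteq> 0"
    "fls_X = coord i a / coord i b"
    by (rule coord_fraction)
  obtain f g where fg: "a = of_series f" "b = of_series g"
    using ab of_series_surj by metis
  have "fls_X * coord i b = coord i a"
    unfolding ab(4) using ab(3) by simp
  hence "fls_X * fps_to_fls (series_coord g) = fps_to_fls (series_coord f)"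
    by (simp add: fps_to_fls_series_coord fg)
  hence "fps_X * series_coord g = series_coord f"
    by (simp flip: fps_to_fls_eq_iff add: fls_times_fps_to_fls)
  moreover have "series_coord g \<noteq> 0"
    using ab fg fps_to_fls_series_coord[of g] by auto
  ultimately have "subdegree (series_coord f) = Suc (subdegree (series_coord g))"
    by (metis fps_X_neq_zero subdegree_fps_X subdegree_mult plus_1_eq_Suc)
  thus ?thesis by (intro exI[of _ f]) simp
qed

end

section \<open>Elements supported on a single branch\<close>

definition supported :: "nat \<Rightarrow> ('n, 'k) mps set \<Rightarrow> bool" where
  "supported i x \<longleftrightarrow> x \<in> carrier \<O> \<and> (\<forall>l\<in>branches C. l \<noteq> i \<longrightarrow> coord l x = 0)"

lemma supported_add: "\<lbrakk>supported i x; supported i y\<rbrakk> \<Longrightarrow> supported i (x \<oplus>\<^bsub>\<O>\<^esub> y)"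
  by (simp add: supported_def coord_add)

lemma supported_mult: "\<lbrakk>supported i x; y \<in> carrier \<O>\<rbrakk> \<Longrightarrow> supported i (x \<otimes>\<^bsub>\<O>\<^esub> y)"
  by (simp add: supported_def coord_mult)

lemma supported_zero: "supported i \<zero>\<^bsub>\<O>\<^esub>"
  by (simp add: supported_def coord_zero)

text \<open>Distinct minimal primes are incomparable, so some element avoids the prime of branch
  \<open>i\<close> and lies in all the others.\<close>

lemma ex_supported_nonzero:
  assumes i: "i \<in> branches C"
  shows "\<exists>h. supported i h \<and> coord i h \<noteq> 0"
proof -
  have "\<exists>h\<in>carrier \<O>. h \<notin> branch_prime C i \<and> (\<forall>l\<in>branches C - {i}. h \<in> branch_prime C l)"
    using i branch_prime_not_subset primeideal.axioms(1)[OF branch_prime_primeideal]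
    by (intro ex_separating_element branch_prime_primeideal) auto
  thus ?thesis
    using i by (auto simp: supported_def coord_eq_0_iff)
qed

text \<open>In the induction, the denominator found so far is multiplied by a denominator of t^n.
  The start with an element supported on branch \<open>i\<close> makes all products supported
  there.\<close>

lemma ex_common_denominator:
  assumes i: "i \<in> branches C"
  shows "\<exists>g. supported i g \<and> coord i g \<noteq> 0 \<and>
    (\<forall>j<n. \<exists>d. supported i d \<and> coord i d = coord i g * fls_X ^ j)"
proof (induction n)
  case 0
  thus ?case using ex_supported_nonzero[OF i] by simp
next
  case (Suc n)
  then obtain g where g: "supported i g" "coord i g \<noteq> 0"
    and d: "\<And>j. j < n \<Longrightarrow> \<exists>d. supported i d \<and> coord i d = coord i g * fls_X ^ j"
    by auto
  have gc: "g \<in> carrier \<O>" using g by (simp add: supported_def)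
  obtain a b where ab: "a \<in> carrier \<O>" "b \<in> carrier \<O>" "coord i b \<noteq> 0"
    "fls_X ^ n = coord i a / coord i b"
    using coord_fraction[OF i, of "fls_X ^ n"] by metis
  show ?case
  proof (rule exI[of _ "g \<otimes>\<^bsub>\<O>\<^esub> b"], intro conjI allI impI)
    show "supported i (g \<otimes>\<^bsub>\<O>\<^esub> b)" using g ab by (simp add: supported_mult)
    show "coord i (g \<otimes>\<^bsub>\<O>\<^esub> b) \<noteq> 0" using g gc ab i by (simp add: coord_mult)
    fix j assume "j < Suc n"
    then consider "j < n" | "j = n" by linarith
    thus "\<exists>d. supported i d \<and> coord i d = coord i (g \<otimes>\<^bsub>\<O>\<^esub> b) * fls_X ^ j"
    proof cases
      case 1
      then obtain d where d: "supported i d" "coord i d = coord i g * fls_X ^ j" using d by auto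
      hence "d \<in> carrier \<O>" by (simp add: supported_def)
      with d gc ab i show ?thesis
        by (intro exI[of _ "d \<otimes>\<^bsub>\<O>\<^esub> b"]) (simp add: coord_mult supported_mult)
    next
      case 2
      have "coord i a = coord i b * fls_X ^ n"
        unfolding ab(4) using ab(3) by simp
      with 2 g gc ab(1,2) i show ?thesis
        by (intro exI[of _ "g \<otimes>\<^bsub>\<O>\<^esub> a"]) (simp add: coord_mult supported_mult)
    qed
  qed
qed

text \<open>With \<open>y\<close> the image of \<open>x\<close> and \<open>e\<close> its order,
  every power series is a combination of 1, t, ..., t^(e-1) with coefficients in K[[y]]. These
  coefficients are images of elements of \<O>, and \<open>\<beta>\<close> is the image of a common
  denominator of the powers of t.\<close>

lemma branch_conductor:
  assumes i: "i \<in> branches C"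
  shows "\<exists>\<beta>. \<beta> \<noteq> 0 \<and> (\<forall>f. \<exists>x. supported i x \<and> coord i x = \<beta> * fps_to_fls f)"
proof -
  obtain x where x: "0 < subdegree (series_coord i x)"
    using ex_series_subdegree_pos[OF i] by auto
  have x0: "x (\<lambda>_. 0) = 0" by (rule constant_term_eq_0_if_subdegree_pos[OF i x])
  define y where "y = series_coord i x"
  have y: "y \<noteq> 0" "0 < subdegree y" using x by (auto simp: y_def)
  obtain g where g: "supported i g" "coord i g \<noteq> 0"
    and d: "\<And>j. j < subdegree y \<Longrightarrow> \<exists>d. supported i d \<and> coord i d = coord i g * fls_X ^ j"
    using ex_common_denominator[OF i, of "subdegree y"] by auto
  have "\<exists>x. supported i x \<and> coord i x = coord i g * fps_to_fls f" for f
  proof -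
    obtain H where H: "\<And>N. y ^ N dvd
        f - (\<Sum>j<subdegree y. (\<Sum>q<N. fps_const (H j q) * y ^ q) * fps_X ^ j)"
      using fps_expansion_in_powers[OF y(1), of f] by auto
    \<comment> \<open>\<open>\<sigma> j\<close> stands for the infinite sum of the terms
      \<open>H j q\<close> times \<open>y ^ q\<close>: it agrees with the partial sums modulo every
      power of \<open>y\<close>. The expansion of \<open>f\<close> is then exact, because only zero
      is divisible by all these powers.\<close>
    define \<sigma> where "\<sigma> j = series_coord i (mps_subst x (H j))" for j
    have "y ^ N dvd f - (\<Sum>j<subdegree y. \<sigma> j * fps_X ^ j)" for N
    proof -
      have \<sigma>: "y ^ N dvd \<sigma> j - (\<Sum>q<N. fps_const (H j q) * y ^ q)" for j
        using series_coord_subst[OF i, of x "H j" N] x0 by (simp add: \<sigma>_def y_def)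
      have "f - (\<Sum>j<subdegree y. \<sigma> j * fps_X ^ j) =
          (f - (\<Sum>j<subdegree y. (\<Sum>q<N. fps_const (H j q) * y ^ q) * fps_X ^ j)) -
          (\<Sum>j<subdegree y. (\<sigma> j - (\<Sum>q<N. fps_const (H j q) * y ^ q)) * fps_X ^ j)"
        by (simp add: left_diff_distrib sum_subtractf)
      also have "y ^ N dvd \<dots>"
        by (intro dvd_diff H dvd_sum dvd_mult2 \<sigma>)
      finally show ?thesis .
    qed
    hence "f - (\<Sum>j<subdegree y. \<sigma> j * fps_X ^ j) = 0"
      by (rule fps_eq_0_if_power_dvd[OF y(2)])
    hence f: "f = (\<Sum>j<subdegree y. \<sigma> j * fps_X ^ j)"
      by simp
    \<comment> \<open>The combination is realized in \<O> term by term: \<open>e\<close> supplies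
      the denominator times t^m, and the series in \<open>x\<close> supplies
      \<open>\<sigma> m\<close>.\<close>
    have "m \<le> subdegree y \<Longrightarrow> \<exists>x. supported i x \<and>
        coord i x = coord i g * fps_to_fls (\<Sum>j<m. \<sigma> j * fps_X ^ j)" for m
    proof (induction m)
      case 0
      thus ?case using supported_zero coord_zero[OF i] by (intro exI[of _ "\<zero>\<^bsub>\<O>\<^esub>"]) simp
    next
      case (Suc m)
      then obtain z where z: "supported i z"
        "coord i z = coord i g * fps_to_fls (\<Sum>j<m. \<sigma> j * fps_X ^ j)" by auto
      obtain e where e: "supported i e" "coord i e = coord i g * fls_X ^ m"
        using d[of m] Suc.prems by auto
      define w where "w = e \<otimes>\<^bsub>\<O>\<^esub> of_series (mps_subst x (H m))"
      have c: "e \<in> carrier \<O>" "z \<in> carrier \<O>" using e z by (simp_all add: supported_def)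
      have w: "supported i w" "w \<in> carrier \<O>"
        using supported_mult[OF e(1)] c by (simp_all add: w_def)
      have "coord i w = coord i g * fps_to_fls (\<sigma> m * fps_X ^ m)"
        using c e i by (simp add: w_def coord_mult \<sigma>_def fls_times_fps_to_fls
            fps_to_fls_series_coord fps_to_fls_power)
      with z w c i show ?case
        by (intro exI[of _ "z \<oplus>\<^bsub>\<O>\<^esub> w"]) (simp add: supported_add coord_add distrib_left)
    qed
    from this[of "subdegree y"] show ?thesis by (simp flip: f)
  qed
  with g show ?thesis by blast
qed

end

unbundle Formal_Laurent_Series.fps_syntax

section \<open>Orders of Laurent series\<close>

text \<open>Formulated by coefficients, so that zero has every order and sums require no case
  distinction.\<close>

definition fls_ord_ge :: "int \<Rightarrow> 'k::zero fls \<Rightarrow> bool" where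
  "fls_ord_ge n f \<longleftrightarrow> (\<forall>k<n. f $$ k = 0)"

lemma fls_ord_ge_iff: "fls_ord_ge n f \<longleftrightarrow> f = 0 \<or> n \<le> fls_subdegree f"
  unfolding fls_ord_ge_def using fls_subdegree_geI[of f n] by force

lemma fls_ord_ge_zero [simp]: "fls_ord_ge n 0"
  by (simp add: fls_ord_ge_def)

lemma fls_ord_ge_add:
  fixes f g :: "'k::comm_ring_1 fls"
  shows "\<lbrakk>fls_ord_ge n f; fls_ord_ge n g\<rbrakk> \<Longrightarrow> fls_ord_ge n (f + g)"
  by (simp add: fls_ord_ge_def)

lemma fls_ord_ge_uminus:
  fixes f :: "'k::comm_ring_1 fls"
  shows "fls_ord_ge n f \<Longrightarrow> fls_ord_ge n (- f)"
  by (simp add: fls_ord_ge_def)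

lemma fls_ord_ge_mult_fps:
  fixes f :: "'k::field fls"
  assumes "fls_ord_ge n f"
  shows "fls_ord_ge n (fps_to_fls g * f)"
  using assms fls_subdegree_fls_to_fps_gt0[of g]
  by (cases "fps_to_fls g * f = 0") (auto simp: fls_ord_ge_iff)

lemma fls_ord_ge_0_fps: "fls_ord_ge 0 f \<longleftrightarrow> f \<in> range fps_to_fls"
proof
  assume "fls_ord_ge 0 f"
  hence "f = fps_to_fls (fls_regpart f)"
    by (intro fls_eqI) (auto simp: fls_ord_ge_def)
  thus "f \<in> range fps_to_fls" by blast
qed (auto simp: fls_ord_ge_def)

text \<open>The first shift moves index \<open>n\<close> to 0, \<open>fls_regpart\<close> cuts
  there, and the second shift moves back.\<close>

definition fls_tail :: "int \<Rightarrow> 'k::zero fls \<Rightarrow> 'k fls" where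
  "fls_tail n f = fls_shift (- n) (fps_to_fls (fls_regpart (fls_shift n f)))"

lemma fls_tail_nth: "fls_tail n f $$ k = (if k < n then 0 else f $$ k)"
  by (auto simp: fls_tail_def)

lemma fls_ord_ge_tail: "fls_ord_ge n (fls_tail n f)"
  by (simp add: fls_ord_ge_def fls_tail_nth)

lemma fls_subdegree_minus_tail_less:
  fixes f :: "'k::comm_ring_1 fls"
  assumes "f - fls_tail n f \<noteq> 0"
  shows "fls_subdegree (f - fls_tail n f) < n"
  using nth_fls_subdegree_nonzero[OF assms] by (auto simp: fls_tail_nth split: if_splits)

lemma fls_ord_ge_minus_tail:
  fixes f :: "'k::comm_ring_1 fls"
  assumes "fls_ord_ge m f"
  shows "fls_ord_ge m (f - fls_tail n f)"
  using assms by (auto simp: fls_ord_ge_def fls_tail_nth)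

lemma fls_subdegree_cancel_leading:
  fixes f g :: "'k::field fls"
  assumes "f \<noteq> 0" "g \<noteq> 0" "fls_subdegree f = fls_subdegree g"
  defines "c \<equiv> f $$ fls_subdegree f / g $$ fls_subdegree g"
  shows "fls_ord_ge (fls_subdegree f + 1) (f - fls_const c * g)"
  unfolding fls_ord_ge_def
proof (intro allI impI)
  fix k assume "k < fls_subdegree f + 1"
  then consider "k < fls_subdegree f" | "k = fls_subdegree f" by linarith
  thus "(f - fls_const c * g) $$ k = 0"
    by cases (use assms in \<open>auto simp: c_def\<close>)
qed

text \<open>Zero is removed because its \<open>fls_subdegree\<close> is a default value and not an
  order.\<close>

definition orders :: "'k::zero fls set \<Rightarrow> int set" where
  "orders S = fls_subdegree ` (S - {0})"

lemma orders_mono: "S \<subseteq> T \<Longrightarrow> orders S \<subseteq> orders T"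
  by (auto simp: orders_def)

text \<open>Zero lies in both sets, so the value \<open>Pinf\<close> cancels and only integer values
  remain.\<close>

lemma t_order_image_diff:
  assumes "0 \<in> S" "0 \<in> T"
  shows "t_order ` S - t_order ` T = Fin ` (orders S - orders T)"
  using assms by (auto simp: t_order_def orders_def image_iff split: if_splits)

text \<open>For \<open>n \<ge> c\<close> the monomial t^n lies in \<open>T\<close>, so every order
  from \<open>c\<close> on is attained there.\<close>

lemma orders_diff_subset:
  assumes S: "\<And>f. f \<in> S \<Longrightarrow> fls_ord_ge d f" and T: "\<And>f. fls_ord_ge c f \<Longrightarrow> f \<in> T"
  shows "orders S - orders (T :: 'k::field fls set) \<subseteq> {d..<c}"
proof
  fix n assume n: "n \<in> orders S - orders T"
  have "n \<in> orders T" if "c \<le> n"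
  proof -
    have "fls_X_intpow n \<in> T - {0}" using that T by (auto simp: fls_ord_ge_iff)
    thus ?thesis unfolding orders_def by (metis fls_subdegree_fls_X_intpow image_eqI)
  qed
  with n S show "n \<in> {d..<c}" by (force simp: orders_def fls_ord_ge_iff)
qed

context algebroid_curve
begin

section \<open>Modules over a branch\<close>

lemma branch_module_simps [simp]:
  "carrier (branch_module C i) = UNIV"
  "\<zero>\<^bsub>branch_module C i\<^esub> = 0"
  "f \<oplus>\<^bsub>branch_module C i\<^esub> g = f + g"
  "a \<odot>\<^bsub>branch_module C i\<^esub> f = branch_embed C i a * f"
  by (simp_all add: branch_module_def)

lemma branch_module_module:
  assumes i: "i \<in> branches C"
  shows "module (branch_ring C i) (branch_module C i)"
proof (rule moduleI)
  show "cring (branch_ring C i)" by (rule cring_branch_ring[OF i])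
  show "abelian_group (branch_module C i)"
    by (rule abelian_groupI) (auto simp: algebra_simps intro: exI[of _ "- _"])
  show "(a \<oplus>\<^bsub>branch_ring C i\<^esub> b) \<odot>\<^bsub>branch_module C i\<^esub> f =
      a \<odot>\<^bsub>branch_module C i\<^esub> f \<oplus>\<^bsub>branch_module C i\<^esub> b \<odot>\<^bsub>branch_module C i\<^esub> f"
    if "a \<in> carrier (branch_ring C i)" "b \<in> carrier (branch_ring C i)" for a b f
    using ring_hom_add[OF embed_hom[OF i] that]
    by (simp add: ring_of_type_algebra_def distrib_right)
  show "(a \<otimes>\<^bsub>branch_ring C i\<^esub> b) \<odot>\<^bsub>branch_module C i\<^esub> f =
      a \<odot>\<^bsub>branch_module C i\<^esub> (b \<odot>\<^bsub>branch_module C i\<^esub> f)"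
    if "a \<in> carrier (branch_ring C i)" "b \<in> carrier (branch_ring C i)" for a b f
    using ring_hom_mult[OF embed_hom[OF i] that]
    by (simp add: ring_of_type_algebra_def mult.assoc)
  show "\<one>\<^bsub>branch_ring C i\<^esub> \<odot>\<^bsub>branch_module C i\<^esub> f = f" for f
    using ring_hom_one[OF embed_hom[OF i]] by (simp add: ring_of_type_algebra_def)
qed (auto simp: distrib_left)

lemma branch_module_minus:
  assumes i: "i \<in> branches C"
  shows "\<ominus>\<^bsub>branch_module C i\<^esub> f = - f" "f \<ominus>\<^bsub>branch_module C i\<^esub> g = f - g"
proof -
  interpret B: module "branch_ring C i" "branch_module C i" by (rule branch_module_module[OF i])
  have *: "\<ominus>\<^bsub>branch_module C i\<^esub> f = - f" for f
    by (rule B.minus_equality) auto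
  show "\<ominus>\<^bsub>branch_module C i\<^esub> f = - f" "f \<ominus>\<^bsub>branch_module C i\<^esub> g = f - g"
    by (simp_all add: * a_minus_def)
qed

lemma embed_integral:
  assumes i: "i \<in> branches C" and a: "a \<in> carrier (branch_ring C i)"
  shows "branch_embed C i a \<in> range fps_to_fls"
proof -
  obtain x where "x \<in> carrier \<O>" "a = curve_to_branch C i x" using a by (rule curve_to_branch_surj)
  thus ?thesis using coord_integral[OF i, of x] by (simp add: coord_def)
qed

text \<open>Elements of the branch ring act as power series, which do not lower the order; the
  branch ring contains the constants, by which leading coefficients are cancelled.\<close>

lemma branch_valued_module:
  assumes i: "i \<in> branches C"
  shows "valued_module (branch_ring C i) (branch_module C i) fls_subdegree"
proof -
  interpret B: module "branch_ring C i" "branch_module C i" by (rule branch_module_module[OF i])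
  show ?thesis
  proof (rule valued_module.intro[OF branch_module_module[OF i] valued_module_axioms.intro])
    fix s :: int
    have "submodule {f. fls_ord_ge s f} (branch_ring C i) (branch_module C i)"
      using embed_integral[OF i]
      by (intro B.submoduleI)
        (auto simp: branch_module_minus[OF i] fls_ord_ge_uminus fls_ord_ge_add
          intro!: fls_ord_ge_mult_fps dest!: embed_integral[OF i])
    thus "submodule {z \<in> carrier (branch_module C i). z = \<zero>\<^bsub>branch_module C i\<^esub> \<or>
        s \<le> fls_subdegree z} (branch_ring C i) (branch_module C i)"
      by (simp add: fls_ord_ge_iff)
  next
    fix f g
    assume fg: "f \<noteq> \<zero>\<^bsub>branch_module C i\<^esub>" "g \<noteq> \<zero>\<^bsub>branch_module C i\<^esub>"
      "fls_subdegree f = fls_subdegree g"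
    define c where "c = f $$ fls_subdegree f / g $$ fls_subdegree g"
    define a where "a = curve_to_branch C i (of_series (mps_const c))"
    have a: "a \<in> carrier (branch_ring C i)"
      unfolding a_def by (rule ring_hom_closed[OF curve_to_branch_hom[OF i] of_series_closed])
    moreover have "branch_embed C i a = fls_const c"
      using coord_const[OF i, of c] by (simp add: a_def coord_def)
    moreover have "fls_ord_ge (fls_subdegree f + 1) (f - fls_const c * g)"
      unfolding c_def by (rule fls_subdegree_cancel_leading) (use fg in auto)
    ultimately show "\<exists>c\<in>carrier (branch_ring C i).
        f \<ominus>\<^bsub>branch_module C i\<^esub> c \<odot>\<^bsub>branch_module C i\<^esub> g = \<zero>\<^bsub>branch_module C i\<^esub> \<or>
        fls_subdegree f < fls_subdegree (f \<ominus>\<^bsub>branch_module C i\<^esub> c \<odot>\<^bsub>branch_module C i\<^esub> g)"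
      by (intro bexI[of _ a]) (auto simp: branch_module_minus[OF i] fls_ord_ge_iff)
  qed
qed

lemma branch_quot_length:
  assumes i: "i \<in> branches C"
    and U: "submodule U (branch_ring C i) (branch_module C i)" "\<And>f. f \<in> U \<Longrightarrow> fls_ord_ge d f"
    and V: "submodule V (branch_ring C i) (branch_module C i)" "\<And>f. fls_ord_ge c f \<Longrightarrow> f \<in> V"
    and VU: "V \<subseteq> U"
  shows "quot_length (branch_ring C i) (branch_module C i) U V = enat (card (orders U - orders V))"
proof -
  interpret B: valued_module "branch_ring C i" "branch_module C i" fls_subdegree
    by (rule branch_valued_module[OF i])
  have vals: "B.vals S = orders S" for S by (simp add: B.vals_def orders_def)
  show ?thesis
    unfolding vals[symmetric]
  proof (rule B.quot_length_eq_card_vals[OF U(1) V(1) VU, of "{d..<c}"])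
    fix f assume f: "f \<in> U" "f \<notin> V"
    \<comment> \<open>The terms of order at least \<open>c\<close> form an element of
      \<open>V\<close>. What remains has order below \<open>c\<close>, and at least \<open>d\<close>
      because it still lies in \<open>U\<close>.\<close>
    define g where "g = fls_tail c f"
    have g: "g \<in> V" unfolding g_def by (rule V(2)[OF fls_ord_ge_tail])
    hence fg: "f - g \<in> U"
      using B.submodule_minus_closed[OF U(1) f(1), of g] VU by (auto simp: branch_module_minus[OF i])
    have ne: "f - g \<noteq> 0" using f g by auto
    have "fls_ord_ge (fls_subdegree f) (f - g)"
      unfolding g_def by (rule fls_ord_ge_minus_tail) (simp add: fls_ord_ge_iff)
    thus "\<exists>j\<in>V. fls_subdegree (f \<ominus>\<^bsub>branch_module C i\<^esub> j) \<in> {d..<c} \<and>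
        fls_subdegree f \<le> fls_subdegree (f \<ominus>\<^bsub>branch_module C i\<^esub> j)"
      using g ne U(2)[OF fg] fls_subdegree_minus_tail_less[of f c, folded g_def]
      by (intro bexI[of _ g]) (auto simp: branch_module_minus[OF i] fls_ord_ge_iff)
  qed auto
qed

section \<open>Fractional ideals\<close>

lemma total_fractions_simps:
  "carrier (total_fractions C) = branches C \<rightarrow>\<^sub>E UNIV"
  "\<zero>\<^bsub>total_fractions C\<^esub> = (\<lambda>i\<in>branches C. 0)"
  "y \<oplus>\<^bsub>total_fractions C\<^esub> z = (\<lambda>i\<in>branches C. y i + z i)"
  "x \<odot>\<^bsub>total_fractions C\<^esub> z = (\<lambda>i\<in>branches C. coord i x * z i)"
  by (auto simp: total_fractions_def curve_embed_def coord_def)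

lemma total_fractions_eqI:
  assumes "y \<in> carrier (total_fractions C)" "z \<in> carrier (total_fractions C)"
    and "\<And>i. i \<in> branches C \<Longrightarrow> y i = z i"
  shows "y = z"
  using assms by (auto simp: total_fractions_simps intro: PiE_ext)

lemma total_fractions_module: "module \<O> (total_fractions C)"
proof (rule moduleI)
  show "cring \<O>" by (rule is_cring)
  show "abelian_group (total_fractions C)"
  proof (rule abelian_groupI, goal_cases)
    case (6 z)
    show ?case
      by (rule bexI[of _ "\<lambda>i\<in>branches C. - z i"]) (auto simp: total_fractions_simps)
  qed (auto simp: total_fractions_simps algebra_simps intro!: ext)
qed (auto simp: total_fractions_simps coord_add coord_mult coord_one algebra_simps intro!: ext)

sublocale total: module \<O> "total_fractions C"
  by (rule total_fractions_module)

lemma total_fractions_minus: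
  "z \<in> carrier (total_fractions C) \<Longrightarrow> \<ominus>\<^bsub>total_fractions C\<^esub> z = (\<lambda>i\<in>branches C. - z i)"
  "\<lbrakk>y \<in> carrier (total_fractions C); z \<in> carrier (total_fractions C)\<rbrakk> \<Longrightarrow>
    y \<ominus>\<^bsub>total_fractions C\<^esub> z = (\<lambda>i\<in>branches C. y i - z i)"
proof -
  show *: "\<ominus>\<^bsub>total_fractions C\<^esub> z = (\<lambda>i\<in>branches C. - z i)"
    if "z \<in> carrier (total_fractions C)" for z
    by (rule total.minus_equality) (use that in \<open>auto simp: total_fractions_simps\<close>)
  show "y \<ominus>\<^bsub>total_fractions C\<^esub> z = (\<lambda>i\<in>branches C. y i - z i)"
    if "y \<in> carrier (total_fractions C)" "z \<in> carrier (total_fractions C)" for y z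
    using that by (auto simp: a_minus_def * total_fractions_simps(3))
qed

text \<open>A regular element avoids all minimal primes, and these are the kernels of the
  coordinates.\<close>

lemma regular_coord_nonzero:
  assumes "regular_element \<O> g" "i \<in> branches C"
  shows "coord i g \<noteq> 0"
  using assms regular_element_notin_minimal_prime[OF branch_prime_minimal] coord_eq_0_iff
  by (auto simp: regular_element_def)

section \<open>Lower bound, conductor and projections of a fractional ideal\<close>

context
  fixes I assumes I: "fractional_ideal C I"
begin

lemma fractional_submodule: "submodule I \<O> (total_fractions C)"
  using I by (simp add: fractional_ideal_def)

lemma fractional_subset: "z \<in> I \<Longrightarrow> z \<in> carrier (total_fractions C)"
  using total.submoduleE(1)[OF fractional_submodule] by auto

text \<open>A regular \<open>g\<close> carries \<open>I\<close> into \<O>, whose elements have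
  nonnegative orders, so the orders in \<open>I\<close> are bounded below by the least of the
  negated orders of \<open>g\<close>.\<close>

lemma fractional_bounded: "\<exists>d. \<forall>z\<in>I. \<forall>i\<in>branches C. fls_ord_ge d (z i)"
proof -
  obtain g where g: "regular_element \<O> g" "g \<in> carrier \<O>"
    "\<And>z. z \<in> I \<Longrightarrow> g \<odot>\<^bsub>total_fractions C\<^esub> z \<in> curve_embed C ` carrier \<O>"
    using I by (auto simp: fractional_ideal_def regular_element_def)
  obtain d where d: "\<And>i. i \<in> branches C \<Longrightarrow> d \<le> - fls_subdegree (coord i g)"
    by (rule that[of "Min ((\<lambda>i. - fls_subdegree (coord i g)) ` branches C)"]) simp
  have "fls_ord_ge d (z i)" if z: "z \<in> I" and i: "i \<in> branches C" for z i
  proof -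
    obtain x where x: "x \<in> carrier \<O>" "g \<odot>\<^bsub>total_fractions C\<^esub> z = curve_embed C x"
      using g(3)[OF z] by auto
    from fun_cong[OF x(2), of i] have "coord i g * z i = coord i x"
      using i by (simp add: total_fractions_simps curve_embed_def coord_def)
    hence "fls_ord_ge 0 (coord i g * z i)"
      using coord_integral[OF i x(1)] by (simp add: fls_ord_ge_0_fps)
    thus ?thesis
      using regular_coord_nonzero[OF g(1) i] d[OF i] by (auto simp: fls_ord_ge_iff)
  qed
  thus ?thesis by blast
qed

text \<open>A component \<open>z i\<close> of order at least that of
  \<open>\<beta> i * coord i g\<close> is this product times a power series. By
  \<open>branch_conductor\<close>, some element of \<O> supported on branch \<open>i\<close> then
  multiplies \<open>g\<close> into the vector with the single entry \<open>z i\<close>, and these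
  vectors add up to \<open>z\<close>.\<close>

lemma fractional_conductor:
  "\<exists>c. \<forall>z\<in>carrier (total_fractions C). (\<forall>i\<in>branches C. fls_ord_ge c (z i)) \<longrightarrow> z \<in> I"
proof -
  obtain g where g: "regular_element \<O> g" "g \<in> carrier \<O>" "curve_embed C g \<in> I"
    using I by (auto simp: fractional_ideal_def regular_element_def)
  obtain \<beta> where \<beta>: "\<And>i. i \<in> branches C \<Longrightarrow> \<beta> i \<noteq> 0"
    "\<And>i f. i \<in> branches C \<Longrightarrow> \<exists>x. supported i x \<and> coord i x = \<beta> i * fps_to_fls f"
    using branch_conductor by metis
  obtain c where c: "\<And>i. i \<in> branches C \<Longrightarrow> fls_subdegree (\<beta> i * coord i g) \<le> c"
    by (rule that[of "Max ((\<lambda>i. fls_subdegree (\<beta> i * coord i g)) ` branches C)"]) simp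
  have "z \<in> I" if z: "z \<in> carrier (total_fractions C)"
    and ord: "\<And>i. i \<in> branches C \<Longrightarrow> fls_ord_ge c (z i)" for z
  proof -
    have single: "(\<lambda>l\<in>branches C. if l = i then z i else 0) \<in> I" if i: "i \<in> branches C" for i
    proof -
      define h where "h = \<beta> i * coord i g"
      have h: "h \<noteq> 0" using \<beta>(1)[OF i] regular_coord_nonzero[OF g(1) i] by (simp add: h_def)
      have "fls_ord_ge 0 (z i / h)"
        using ord[OF i] c[OF i] h
        by (cases "z i = 0") (auto simp: fls_ord_ge_iff fls_divide_subdegree simp flip: h_def)
      then obtain f where f: "z i / h = fps_to_fls f" by (auto simp: fls_ord_ge_0_fps)
      obtain x where x: "supported i x" "coord i x = \<beta> i * fps_to_fls f"
        using \<beta>(2)[OF i] by blast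
      have "z i = h * fps_to_fls f" unfolding f[symmetric] using h by simp
      hence "coord l x * coord l g = (if l = i then z i else 0)" if "l \<in> branches C" for l
        using x that by (simp add: supported_def h_def mult_ac)
      hence "(\<lambda>l\<in>branches C. if l = i then z i else 0) = x \<odot>\<^bsub>total_fractions C\<^esub> curve_embed C g"
        by (auto simp: total_fractions_simps curve_embed_def coord_def)
      also have "\<dots> \<in> I"
        using total.submoduleE(4)[OF fractional_submodule _ g(3)] x by (simp add: supported_def)
      finally show ?thesis .
    qed
    \<comment> \<open>Components are added one by one. Branches are numbered from 1, so the bound
      \<open>m = 0\<close> leaves the zero vector.\<close>
    have "(\<lambda>l\<in>branches C. if l \<le> m then z l else 0) \<in> I" for m
    proof (induction m)
      case 0
      have "(\<lambda>l\<in>branches C. if l \<le> 0 then z l else 0) = \<zero>\<^bsub>total_fractions C\<^esub>"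
        by (auto simp: total_fractions_simps)
      thus ?case using total.submodule_zero_closed[OF fractional_submodule] by simp
    next
      case (Suc m)
      show ?case
      proof (cases "Suc m \<in> branches C")
        case True
        have "(\<lambda>l\<in>branches C. if l \<le> Suc m then z l else 0) =
            (\<lambda>l\<in>branches C. if l \<le> m then z l else 0) \<oplus>\<^bsub>total_fractions C\<^esub>
            (\<lambda>l\<in>branches C. if l = Suc m then z (Suc m) else 0)"
          by (auto simp: total_fractions_simps fun_eq_iff le_Suc_eq)
        also have "\<dots> \<in> I"
          by (rule total.submoduleE(5)[OF fractional_submodule Suc single[OF True]])
        finally show ?thesis .
      next
        case False
        hence "(\<lambda>l\<in>branches C. if l \<le> Suc m then z l else 0) =
            (\<lambda>l\<in>branches C. if l \<le> m then z l else 0)"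
          by (auto simp: fun_eq_iff)
        thus ?thesis using Suc by simp
      qed
    qed
    moreover have "(\<lambda>l\<in>branches C. if l \<le> num_branches C then z l else 0) = z"
      using z by (intro total_fractions_eqI) (auto simp: total_fractions_simps)
    ultimately show ?thesis by metis
  qed
  thus ?thesis by blast
qed

text \<open>A scalar of the branch ring lifts to \<O>, and the action of \<O> preserves vanishing on
  \<open>L\<close>. The case \<open>L = {}\<close> covers the projection of the whole ideal.\<close>

lemma projection_submodule:
  assumes i: "i \<in> branches C" and L: "L \<subseteq> branches C"
  shows "submodule (branch_proj i ` vanishing_part L I) (branch_ring C i) (branch_module C i)"
proof -
  interpret B: module "branch_ring C i" "branch_module C i" by (rule branch_module_module[OF i])
  note IE = total.submoduleE[OF fractional_submodule]
  note [simp] = total_fractions_simps vanishing_part_def branch_proj_def branch_module_minus[OF i]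
  show ?thesis
  proof (rule B.submoduleI)
    show "\<zero>\<^bsub>branch_module C i\<^esub> \<in> branch_proj i ` vanishing_part L I"
      using total.submodule_zero_closed[OF fractional_submodule] i L
      by (intro image_eqI[of _ _ "\<zero>\<^bsub>total_fractions C\<^esub>"]) auto
  next
    fix f assume "f \<in> branch_proj i ` vanishing_part L I"
    then obtain z where z: "f = z i" "z \<in> I" "\<forall>l\<in>L. z l = 0" by auto
    thus "\<ominus>\<^bsub>branch_module C i\<^esub> f \<in> branch_proj i ` vanishing_part L I"
      using IE(3)[OF z(2)] fractional_subset[OF z(2)] i L
      by (intro image_eqI[of _ _ "\<ominus>\<^bsub>total_fractions C\<^esub> z"]) (auto simp: total_fractions_minus)
  next
    fix f g assume "f \<in> branch_proj i ` vanishing_part L I" "g \<in> branch_proj i ` vanishing_part L I"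
    then obtain y z where z: "f = y i" "y \<in> I" "\<forall>l\<in>L. y l = 0" "g = z i" "z \<in> I" "\<forall>l\<in>L. z l = 0"
      by auto
    thus "f \<oplus>\<^bsub>branch_module C i\<^esub> g \<in> branch_proj i ` vanishing_part L I"
      using IE(5)[OF z(2,5)] i L
      by (intro image_eqI[of _ _ "y \<oplus>\<^bsub>total_fractions C\<^esub> z"]) auto
  next
    fix a f assume a: "a \<in> carrier (branch_ring C i)" and "f \<in> branch_proj i ` vanishing_part L I"
    then obtain z where z: "f = z i" "z \<in> I" "\<forall>l\<in>L. z l = 0" by auto
    obtain x where x: "x \<in> carrier \<O>" "a = curve_to_branch C i x"
      using a by (rule curve_to_branch_surj)
    from z x show "a \<odot>\<^bsub>branch_module C i\<^esub> f \<in> branch_proj i ` vanishing_part L I"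
      using IE(4)[OF x(1) z(2)] i L
      by (intro image_eqI[of _ _ "x \<odot>\<^bsub>total_fractions C\<^esub> z"]) (auto simp: coord_def)
  qed auto
qed

text \<open>The vector with the single entry \<open>f\<close> on branch \<open>i\<close> lies in
  \<open>I\<close> by the choice of \<open>c\<close>, and it vanishes on \<open>L\<close> as
  \<open>i \<notin> L\<close>.\<close>

lemma projection_conductor:
  assumes i: "i \<in> branches C" and L: "i \<notin> L"
    and c: "\<And>z. \<lbrakk>z \<in> carrier (total_fractions C); \<And>i. i \<in> branches C \<Longrightarrow> fls_ord_ge c (z i)\<rbrakk> \<Longrightarrow> z \<in> I"
    and L': "L \<subseteq> branches C" and f: "fls_ord_ge c f"
  shows "f \<in> branch_proj i ` vanishing_part L I"
proof (rule image_eqI)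
  show "f = branch_proj i (\<lambda>l\<in>branches C. if l = i then f else 0)"
    using i by (simp add: branch_proj_def)
  have "(\<lambda>l\<in>branches C. if l = i then f else 0) \<in> I"
    by (rule c) (use f in \<open>auto simp: total_fractions_simps\<close>)
  thus "(\<lambda>l\<in>branches C. if l = i then f else 0) \<in> vanishing_part L I"
    using L L' by (auto simp: vanishing_part_def branch_proj_def)
qed

end

end

section \<open>The lexicographic valuation\<close>

context algebroid_curve
begin

definition lex_val :: "(nat \<Rightarrow> 'k fls) \<Rightarrow> nat \<times> int" where
  "lex_val z = (let i = LEAST i. i \<in> branches C \<and> z i \<noteq> 0 in (i, fls_subdegree (z i)))"

lemma lex_val_eqI:
  assumes "i \<in> branches C" "z i \<noteq> 0" "\<And>l. \<lbrakk>l \<in> branches C; l < i\<rbrakk> \<Longrightarrow> z l = 0"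
  shows "lex_val z = (i, fls_subdegree (z i))"
proof -
  have "(LEAST i. i \<in> branches C \<and> z i \<noteq> 0) = i"
    by (rule Least_equality) (use assms in \<open>auto simp: not_less[symmetric]\<close>)
  thus ?thesis by (simp add: lex_val_def)
qed

lemma lex_val_cases:
  assumes "z \<in> carrier (total_fractions C)" "z \<noteq> \<zero>\<^bsub>total_fractions C\<^esub>"
  obtains i where "i \<in> branches C" "z i \<noteq> 0" "\<And>l. \<lbrakk>l \<in> branches C; l < i\<rbrakk> \<Longrightarrow> z l = 0"
    "lex_val z = (i, fls_subdegree (z i))"
proof -
  define i where "i = (LEAST i. i \<in> branches C \<and> z i \<noteq> 0)"
  have "\<exists>i. i \<in> branches C \<and> z i \<noteq> 0"
  proof (rule ccontr)
    assume "\<not> ?thesis"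
    hence "z = \<zero>\<^bsub>total_fractions C\<^esub>"
      using assms(1) by (intro total_fractions_eqI) (auto simp: total_fractions_simps)
    with assms(2) show False by simp
  qed
  from LeastI_ex[OF this] have i: "i \<in> branches C" "z i \<noteq> 0" by (auto simp: i_def)
  moreover have "z l = 0" if "l \<in> branches C" "l < i" for l
    using not_less_Least[of l "\<lambda>i. i \<in> branches C \<and> z i \<noteq> 0"] that by (auto simp: i_def)
  ultimately show ?thesis using that lex_val_eqI by blast
qed

text \<open>This is the filtration in coordinates; the components after branch \<open>p\<close> are
  unrestricted. Numbers \<open>p\<close> outside the branches are included because
  \<open>valued_module\<close> asks for a submodule at every pair.\<close>

lemma lex_val_ge_iff:
  assumes "z \<in> carrier (total_fractions C)"
  shows "z = \<zero>\<^bsub>total_fractions C\<^esub> \<or> (p, n) \<le> lex_val z \<longleftrightarrow>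
    (\<forall>l\<in>branches C. l < p \<longrightarrow> z l = 0) \<and> (p \<in> branches C \<longrightarrow> fls_ord_ge n (z p))"
proof (cases "z = \<zero>\<^bsub>total_fractions C\<^esub>")
  case True
  thus ?thesis by (auto simp: total_fractions_simps)
next
  case False
  from assms this obtain i where i: "i \<in> branches C" "z i \<noteq> 0"
    "\<And>l. \<lbrakk>l \<in> branches C; l < i\<rbrakk> \<Longrightarrow> z l = 0" "lex_val z = (i, fls_subdegree (z i))"
    by (rule lex_val_cases) auto
  consider "p < i" | "p = i" | "i < p" by linarith
  thus ?thesis
    by cases (use False i in \<open>auto simp: fls_ord_ge_iff\<close>)
qed

text \<open>The coordinate conditions of \<open>lex_val_ge_iff\<close> are stable under
  multiplication by power series. Elements of equal value share their first branch and the order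
  there; cancelling the leading coefficients by a constant keeps the earlier components zero and
  raises the order on that branch.\<close>

sublocale total: valued_module \<O> "total_fractions C" lex_val
proof (rule valued_module.intro[OF total_fractions_module valued_module_axioms.intro])
  fix s :: "nat \<times> int"
  obtain p n where s: "s = (p, n)" by (cases s)
  define F where "F = {z \<in> carrier (total_fractions C).
    (\<forall>l\<in>branches C. l < p \<longrightarrow> z l = 0) \<and> (p \<in> branches C \<longrightarrow> fls_ord_ge n (z p))}"
  have "submodule F \<O> (total_fractions C)"
  proof (rule total.submoduleI)
    fix x z assume "x \<in> carrier \<O>" "z \<in> F"
    moreover have "fls_ord_ge n (coord p x * z p)"
      if "p \<in> branches C" "fls_ord_ge n (z p)"
      using coord_integral[OF that(1) \<open>x \<in> carrier \<O>\<close>] that(2) by (auto intro: fls_ord_ge_mult_fps)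
    ultimately show "x \<odot>\<^bsub>total_fractions C\<^esub> z \<in> F"
      by (auto simp: F_def total_fractions_simps)
  next
    fix z assume z: "z \<in> F"
    thus "\<ominus>\<^bsub>total_fractions C\<^esub> z \<in> F"
      by (subst total_fractions_minus)
        (auto simp: F_def total_fractions_simps fls_ord_ge_uminus)
  qed (auto simp: F_def total_fractions_simps fls_ord_ge_add)
  moreover have "F = {z \<in> carrier (total_fractions C). z = \<zero>\<^bsub>total_fractions C\<^esub> \<or> s \<le> lex_val z}"
    unfolding F_def s using lex_val_ge_iff by blast
  ultimately show "submodule {z \<in> carrier (total_fractions C).
      z = \<zero>\<^bsub>total_fractions C\<^esub> \<or> s \<le> lex_val z} \<O> (total_fractions C)"
    by simp
next
  fix y z
  assume y: "y \<in> carrier (total_fractions C)" "y \<noteq> \<zero>\<^bsub>total_fractions C\<^esub>"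
    and z: "z \<in> carrier (total_fractions C)" "z \<noteq> \<zero>\<^bsub>total_fractions C\<^esub>"
    and eq: "lex_val y = lex_val z"
  obtain i where i: "i \<in> branches C" "y i \<noteq> 0" "\<And>l. \<lbrakk>l \<in> branches C; l < i\<rbrakk> \<Longrightarrow> y l = 0"
    "lex_val y = (i, fls_subdegree (y i))"
    using lex_val_cases[OF y] by metis
  obtain k where k: "k \<in> branches C" "z k \<noteq> 0" "\<And>l. \<lbrakk>l \<in> branches C; l < k\<rbrakk> \<Longrightarrow> z l = 0"
    "lex_val z = (k, fls_subdegree (z k))"
    using lex_val_cases[OF z] by metis
  have ki: "k = i" "fls_subdegree (z i) = fls_subdegree (y i)"
    using i k eq by auto
  define c where "c = y i $$ fls_subdegree (y i) / z i $$ fls_subdegree (z i)"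
  define x where "x = of_series (mps_const c)"
  define w where "w = y \<ominus>\<^bsub>total_fractions C\<^esub> x \<odot>\<^bsub>total_fractions C\<^esub> z"
  have x: "x \<in> carrier \<O>" by (simp add: x_def)
  have xz: "x \<odot>\<^bsub>total_fractions C\<^esub> z \<in> carrier (total_fractions C)" using x z by simp
  have w: "w l = y l - fls_const c * z l" if "l \<in> branches C" for l
    unfolding w_def total_fractions_minus(2)[OF y(1) xz]
    using that by (simp add: total_fractions_simps x_def coord_const)
  have wc: "w \<in> carrier (total_fractions C)" unfolding w_def using y xz by simp
  have "fls_ord_ge (fls_subdegree (y i) + 1) (w i)"
    unfolding w[OF i(1)] c_def using i k ki by (intro fls_subdegree_cancel_leading) auto
  moreover have "w l = 0" if "l \<in> branches C" "l < i" for l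
    using w[OF that(1)] i(3)[OF that] k(3)[OF that(1)] that ki by simp
  ultimately have "w = \<zero>\<^bsub>total_fractions C\<^esub> \<or> (i, fls_subdegree (y i) + 1) \<le> lex_val w"
    by (subst lex_val_ge_iff[OF wc]) auto
  moreover have "(i, fls_subdegree (y i)) < (i, fls_subdegree (y i) + 1)" by simp
  ultimately have "w = \<zero>\<^bsub>total_fractions C\<^esub> \<or> lex_val y < lex_val w"
    using i(4) by (metis less_le_trans)
  thus "\<exists>c\<in>carrier \<O>.
      y \<ominus>\<^bsub>total_fractions C\<^esub> c \<odot>\<^bsub>total_fractions C\<^esub> z = \<zero>\<^bsub>total_fractions C\<^esub> \<or>
      lex_val y < lex_val (y \<ominus>\<^bsub>total_fractions C\<^esub> c \<odot>\<^bsub>total_fractions C\<^esub> z)"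
    using x unfolding w_def by blast
qed

text \<open>A value with first entry \<open>i\<close> comes from an element that vanishes on all
  earlier branches but not on \<open>i\<close>. The set thus splits by branches, and counting it
  becomes a sum.\<close>

lemma lex_vals_eq:
  assumes "S \<subseteq> carrier (total_fractions C)"
  shows "total.vals S = Sigma (branches C) (\<lambda>i. orders (branch_proj i ` vanishing_part {1..<i} S))"
proof (rule equalityI; rule subsetI)
  fix s assume "s \<in> total.vals S"
  then obtain z where z: "z \<in> S" "z \<noteq> \<zero>\<^bsub>total_fractions C\<^esub>" "s = lex_val z"
    by (auto simp: total.vals_def)
  with assms have "z \<in> carrier (total_fractions C)" by auto
  then obtain i where i: "i \<in> branches C" "z i \<noteq> 0"
    "\<And>l. \<lbrakk>l \<in> branches C; l < i\<rbrakk> \<Longrightarrow> z l = 0" "lex_val z = (i, fls_subdegree (z i))"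
    using lex_val_cases z(2) by metis
  have "z \<in> vanishing_part {1..<i} S"
    using z i by (auto simp: vanishing_part_def branch_proj_def)
  thus "s \<in> Sigma (branches C) (\<lambda>i. orders (branch_proj i ` vanishing_part {1..<i} S))"
    using i z(3) by (auto simp: orders_def branch_proj_def intro!: image_eqI[of _ _ "z i"])
next
  fix s assume "s \<in> Sigma (branches C) (\<lambda>i. orders (branch_proj i ` vanishing_part {1..<i} S))"
  then obtain i f where f: "s = (i, fls_subdegree f)" "i \<in> branches C" "f \<noteq> 0"
    "f \<in> branch_proj i ` vanishing_part {1..<i} S"
    unfolding orders_def by blast
  then obtain z where "f = z i" "z \<in> S" "\<forall>l\<in>{1..<i}. z l = 0"
    by (auto simp: vanishing_part_def branch_proj_def)
  with f have z: "s = (i, fls_subdegree (z i))" "i \<in> branches C" "z \<in> S" "z i \<noteq> 0"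
    "\<And>l. \<lbrakk>l \<in> branches C; l < i\<rbrakk> \<Longrightarrow> z l = 0"
    by auto
  have "z \<noteq> \<zero>\<^bsub>total_fractions C\<^esub>" using z by (auto simp: total_fractions_simps)
  moreover have "lex_val z = s" unfolding z(1) by (rule lex_val_eqI[of i z, OF z(2,4,5)])
  ultimately show "s \<in> total.vals S" using z(3) by (auto simp: total.vals_def)
qed

text \<open>As on a single branch, the tails from order \<open>c\<close> on are subtracted, here in
  all components at once. The remainder is nonzero, and its nonzero components have orders from
  \<open>d\<close> up to \<open>c - 1\<close>, whichever branch comes first.\<close>

lemma fractional_quot_length:
  assumes I: "fractional_ideal C I" and J: "fractional_ideal C J" and JI: "J \<subseteq> I"
  shows "quot_length \<O> (total_fractions C) I J = enat (card (total.vals I - total.vals J))"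
proof -
  obtain d where d: "\<And>z i. \<lbrakk>z \<in> I; i \<in> branches C\<rbrakk> \<Longrightarrow> fls_ord_ge d (z i)"
    using fractional_bounded[OF I] by blast
  obtain c where c: "\<And>z. \<lbrakk>z \<in> carrier (total_fractions C);
      \<And>i. i \<in> branches C \<Longrightarrow> fls_ord_ge c (z i)\<rbrakk> \<Longrightarrow> z \<in> J"
    using fractional_conductor[OF J] by blast
  show ?thesis
  proof (rule total.quot_length_eq_card_vals[OF fractional_submodule[OF I]
        fractional_submodule[OF J] JI, of "branches C \<times> {d..<c}"])
    fix z assume z: "z \<in> I" "z \<notin> J"
    have zc: "z \<in> carrier (total_fractions C)" by (rule fractional_subset[OF I z(1)])
    define j where "j = (\<lambda>i\<in>branches C. fls_tail c (z i))"
    define w where "w = z \<ominus>\<^bsub>total_fractions C\<^esub> j"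
    have jc: "j \<in> carrier (total_fractions C)" by (simp add: j_def total_fractions_simps)
    have j: "j \<in> J" by (rule c[OF jc]) (simp add: j_def fls_ord_ge_tail)
    have w: "w l = z l - fls_tail c (z l)" if "l \<in> branches C" for l
      unfolding w_def total_fractions_minus(2)[OF zc jc] using that by (simp add: j_def)
    have wI: "w \<in> I"
      unfolding w_def using j JI z(1)
      by (intro total.submodule_minus_closed[OF fractional_submodule[OF I]]) auto
    have wc: "w \<in> carrier (total_fractions C)" by (rule fractional_subset[OF I wI])
    have ne: "w \<noteq> \<zero>\<^bsub>total_fractions C\<^esub>"
    proof
      assume "w = \<zero>\<^bsub>total_fractions C\<^esub>"
      hence "z = j" using total.minus_add_cancel[OF zc jc] jc by (simp flip: w_def)
      with j z show False by simp
    qed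
    obtain k where k: "k \<in> branches C" "w k \<noteq> 0" "lex_val w = (k, fls_subdegree (w k))"
      using lex_val_cases[OF wc ne] by metis
    have "fls_subdegree (w k) < c"
      using fls_subdegree_minus_tail_less[of "z k" c] w[OF k(1)] k(2) by simp
    moreover have "d \<le> fls_subdegree (w k)"
      using d[OF wI k(1)] k(2) by (simp add: fls_ord_ge_iff)
    ultimately have mem: "lex_val w \<in> branches C \<times> {d..<c}" using k by simp
    have "z \<noteq> \<zero>\<^bsub>total_fractions C\<^esub>"
      using z total.submodule_zero_closed[OF fractional_submodule[OF J]] by auto
    then obtain i where i: "i \<in> branches C" "\<And>l. \<lbrakk>l \<in> branches C; l < i\<rbrakk> \<Longrightarrow> z l = 0"
      "lex_val z = (i, fls_subdegree (z i))"
      using lex_val_cases[OF zc] by metis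
    \<comment> \<open>Truncation keeps zero components zero and does not lower orders. If the
      component of \<open>z\<close> on its first branch is cut away entirely, the first branch of
      \<open>w\<close> is a later one, which is again a larger value.\<close>
    have "w l = 0" if "l \<in> branches C" "l < i" for l
      using w[OF that(1)] i(2)[OF that] by (simp add: fls_tail_def)
    moreover have "fls_ord_ge (fls_subdegree (z i)) (w i)"
      unfolding w[OF i(1)] by (rule fls_ord_ge_minus_tail) (simp add: fls_ord_ge_iff)
    ultimately have "lex_val z \<le> lex_val w"
      unfolding i(3) using lex_val_ge_iff[OF wc, of i "fls_subdegree (z i)"] ne by blast
    with mem j show "\<exists>j\<in>J. lex_val (z \<ominus>\<^bsub>total_fractions C\<^esub> j) \<in> branches C \<times> {d..<c} \<and>
        lex_val z \<le> lex_val (z \<ominus>\<^bsub>total_fractions C\<^esub> j)"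
      unfolding w_def by (intro bexI[of _ j] conjI)
  qed auto
qed

end

section \<open>The length formula\<close>

lemma card_diff_chain:
  assumes "A \<subseteq> B" "B \<subseteq> D" "finite (D - A)"
  shows "card (D - A) = card (D - B) + card (B - A)"
proof -
  have "D - A = (D - B) \<union> (B - A)" using assms by auto
  moreover have "finite (D - B)" "finite (B - A)"
    using assms by (auto intro: finite_subset[OF _ assms(3)])
  ultimately show ?thesis by (simp add: card_Un_disjoint disjoint_iff)
qed

text \<open>The subtraction makes the first formula one of integers. Finiteness of the lengths and
  of the sets is therefore part of the claim; it ensures that \<open>the_enat\<close> and
  \<open>card\<close> do not return default values.\<close>

theorem corollary2p9:
  fixes C :: "('n::finite, 'k::alg_closed_field) curve"
    and I J :: "(nat \<Rightarrow> 'k fls) set"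
  assumes "reduced_algebroid_curve C"
    and "fractional_ideal C I"
    and "fractional_ideal C J"
    and "J \<subseteq> I"
  shows
    "quot_length (curve_ring C) (total_fractions C) I J \<noteq> infinity \<and>
     (\<forall>i\<in>branches C.
        quot_length (branch_ring C i) (branch_module C i)
          (branch_proj i ` I) (branch_proj i ` J) \<noteq> infinity \<and>
        finite (t_order ` branch_proj i ` J - branch_val i ` vanishing_part {1..<i} J) \<and>
        finite (t_order ` branch_proj i ` I - branch_val i ` vanishing_part {1..<i} I)) \<and>
     int (the_enat (quot_length (curve_ring C) (total_fractions C) I J)) =
       (\<Sum>i\<in>branches C.
          int (the_enat (quot_length (branch_ring C i) (branch_module C i)
            (branch_proj i ` I) (branch_proj i ` J)))
          + int (card (t_order ` branch_proj i ` J - branch_val i ` vanishing_part {1..<i} J))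
          - int (card (t_order ` branch_proj i ` I - branch_val i ` vanishing_part {1..<i} I))) \<and>
     quot_length (curve_ring C) (total_fractions C) I J =
       (\<Sum>i\<in>branches C.
          quot_length (branch_ring C i) (branch_module C i)
            (branch_proj i ` vanishing_part {1..<i} I)
            (branch_proj i ` vanishing_part {1..<i} J))"
proof -
  interpret algebroid_curve C by unfold_locales (rule assms(1))
  note I = assms(2) and J = assms(3) and JI = assms(4)
  obtain d where d: "\<And>z i. \<lbrakk>z \<in> I; i \<in> branches C\<rbrakk> \<Longrightarrow> fls_ord_ge d (z i)"
    using fractional_bounded[OF I] by blast
  obtain c where c: "\<And>z. \<lbrakk>z \<in> carrier (total_fractions C);
      \<And>i. i \<in> branches C \<Longrightarrow> fls_ord_ge c (z i)\<rbrakk> \<Longrightarrow> z \<in> J"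
    using fractional_conductor[OF J] by blast
  define N where "N i S = branch_proj i ` vanishing_part {1..<i} S" for i and S :: "(nat \<Rightarrow> 'k fls) set"
  have N_eq: "branch_val i ` vanishing_part {1..<i} S = t_order ` N i S" for i S
    by (simp add: N_def image_image branch_val_def)
  have proj: "branch_proj i ` vanishing_part {} S = branch_proj i ` S" for i and S :: "(nat \<Rightarrow> 'k fls) set"
    by (simp add: vanishing_part_def)
  have N_sub: "N i S \<subseteq> branch_proj i ` S" for i S
    by (auto simp: N_def vanishing_part_def)
  have N_mono: "N i J \<subseteq> N i I" for i using JI by (auto simp: N_def vanishing_part_def)
  have bound: "fls_ord_ge d f" if "i \<in> branches C" "f \<in> branch_proj i ` I" for i f
    using that d by (auto simp: branch_proj_def)
  have cond: "f \<in> N i J" if "i \<in> branches C" "fls_ord_ge c f" for i f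
    unfolding N_def by (rule projection_conductor[OF J that(1) _ c _ that(2)]) (use that in auto)
  \<comment> \<open>All sets of orders on branch \<open>i\<close> lie between those of
    \<open>N i J\<close> and of the projection of \<open>I\<close>, so this finiteness covers every
    difference below.\<close>
  have fin: "finite (orders (branch_proj i ` I) - orders (N i J))" if "i \<in> branches C" for i
    by (rule finite_subset[OF orders_diff_subset[of _ d c]])
      (use bound[OF that] cond[OF that] in auto)
  have Nsubmod: "submodule (N i S) (branch_ring C i) (branch_module C i)"
    "submodule (branch_proj i ` S) (branch_ring C i) (branch_module C i)"
    if "i \<in> branches C" "fractional_ideal C S" for i S
    unfolding N_def
    by (rule projection_submodule[OF that(2,1)], use that(1) in auto)
      (rule projection_submodule[OF that(2,1), of "{}", unfolded proj], simp)
  have zero: "0 \<in> N i S" "0 \<in> branch_proj i ` S" if "i \<in> branches C" "fractional_ideal C S" for i S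
    using module.submodule_zero_closed[OF branch_module_module[OF that(1)]] Nsubmod[OF that]
    by auto
  define \<delta> where "\<delta> i = card (orders (N i I) - orders (N i J))" for i
  have len_N: "quot_length (branch_ring C i) (branch_module C i) (N i I) (N i J) = enat (\<delta> i)"
    if i: "i \<in> branches C" for i
    unfolding \<delta>_def
    by (rule branch_quot_length[OF i Nsubmod(1)[OF i I] _ Nsubmod(1)[OF i J] _ N_mono, of d c])
      (use bound[OF i] N_sub[of i I] cond[OF i] in auto)
  have len_I: "quot_length (branch_ring C i) (branch_module C i) (branch_proj i ` I) (branch_proj i ` J) =
      enat (card (orders (branch_proj i ` I) - orders (branch_proj i ` J)))"
    if i: "i \<in> branches C" for i
    by (rule branch_quot_length[OF i Nsubmod(2)[OF i I] _ Nsubmod(2)[OF i J], of d c])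
      (use bound[OF i] N_sub[of i J] cond[OF i] JI in auto)
  have t_order_diff: "t_order ` branch_proj i ` S - t_order ` N i S =
      Fin ` (orders (branch_proj i ` S) - orders (N i S))"
    if "i \<in> branches C" "fractional_ideal C S" for i S
    by (rule t_order_image_diff[OF zero(2,1)[OF that]])
  have fin_J: "finite (orders (branch_proj i ` J) - orders (N i J))"
    and fin_I: "finite (orders (branch_proj i ` I) - orders (N i I))"
    and count: "int (\<delta> i) = int (card (orders (branch_proj i ` I) - orders (branch_proj i ` J)))
      + int (card (orders (branch_proj i ` J) - orders (N i J)))
      - int (card (orders (branch_proj i ` I) - orders (N i I)))"
    if i: "i \<in> branches C" for i
  proof -
    have sub: "orders (N i J) \<subseteq> orders (N i I)" "orders (N i I) \<subseteq> orders (branch_proj i ` I)"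
      "orders (N i J) \<subseteq> orders (branch_proj i ` J)"
      "orders (branch_proj i ` J) \<subseteq> orders (branch_proj i ` I)"
      by (intro orders_mono N_mono N_sub image_mono JI)+
    show "finite (orders (branch_proj i ` J) - orders (N i J))"
      "finite (orders (branch_proj i ` I) - orders (N i I))"
      using sub by (auto intro!: finite_subset[OF _ fin[OF i]])
    \<comment> \<open>From the orders of \<open>N i J\<close> up to those of the projection of
      \<open>I\<close> one passes either through \<open>N i I\<close> or through the projection of
      \<open>J\<close>; comparing the two counts gives the equation.\<close>
    show "int (\<delta> i) = int (card (orders (branch_proj i ` I) - orders (branch_proj i ` J)))
      + int (card (orders (branch_proj i ` J) - orders (N i J)))
      - int (card (orders (branch_proj i ` I) - orders (N i I)))"
      using card_diff_chain[OF sub(1,2) fin[OF i]] card_diff_chain[OF sub(3,4) fin[OF i]]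
      by (simp add: \<delta>_def)
  qed
  \<comment> \<open>Split by first entries, the missing values number \<open>\<delta> i\<close> on
    branch \<open>i\<close>, and \<open>len_N\<close> reads each \<open>\<delta> i\<close> as a
    length over the branch ring.\<close>
  have "total.vals I - total.vals J = Sigma (branches C) (\<lambda>i. orders (N i I) - orders (N i J))"
    using lex_vals_eq[of I] lex_vals_eq[of J] fractional_subset[OF I] fractional_subset[OF J]
    by (auto simp: N_def subset_iff)
  moreover have "finite (orders (N i I) - orders (N i J))" if "i \<in> branches C" for i
    using orders_mono[OF N_sub[of i I]] by (auto intro: finite_subset[OF _ fin[OF that]])
  ultimately have len: "quot_length (curve_ring C) (total_fractions C) I J = enat (\<Sum>i\<in>branches C. \<delta> i)"
    using fractional_quot_length[OF I J JI] by (simp add: \<delta>_def card_SigmaI)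
  have "(\<Sum>i\<in>branches C. quot_length (branch_ring C i) (branch_module C i) (N i I) (N i J)) =
      (\<Sum>i\<in>branches C. enat (\<delta> i))"
    by (rule sum.cong) (simp_all add: len_N)
  also have "\<dots> = enat (\<Sum>i\<in>branches C. \<delta> i)"
    by (simp flip: of_nat_eq_enat)
  finally have len_sum: "(\<Sum>i\<in>branches C. quot_length (branch_ring C i) (branch_module C i) (N i I) (N i J)) =
      enat (\<Sum>i\<in>branches C. \<delta> i)" .
  have card_t: "card (Fin ` A) = card A" for A :: "int set"
    by (rule card_image) (auto simp: inj_on_def)
  have sum: "int (\<Sum>i\<in>branches C. \<delta> i) = (\<Sum>i\<in>branches C.
          int (the_enat (quot_length (branch_ring C i) (branch_module C i)
            (branch_proj i ` I) (branch_proj i ` J)))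
          + int (card (t_order ` branch_proj i ` J - t_order ` N i J))
          - int (card (t_order ` branch_proj i ` I - t_order ` N i I)))"
    unfolding of_nat_sum
    by (rule sum.cong) (simp_all only: count len_I the_enat.simps t_order_diff[OF _ I] t_order_diff[OF _ J] card_t)
  show ?thesis
    unfolding N_eq N_def[symmetric] len len_sum the_enat.simps sum
    using fin_I fin_J by (simp add: len_I t_order_diff[OF _ I] t_order_diff[OF _ J])
qed

end
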